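(* For every integer $d\ge 3$ and every integer $k\ge 2$, there is a directed $d$-regular graph $G_{k,d}$ on $kd$ vertices such that, for a uniformly random cycle-factor $\sigma\in\mathcal{C}(G_{k,d})$, $$\mathbb{E}\,c(\sigma) > kH_d .$$ Consequently, for every $d\ge 3$ and every multiple $n=kd\ge 2d$ of $d$, the following assertion is false: "the expected number of cycles in a uniformly random cycle-factor of a directed $d$-regular graph on $n$ vertices is uniquely maximised, among all directed $d$-regular graphs on $n$ vertices, by the disjoint union of $n/d$ copies of $K_d^\circ$" (the expected number of cycles for this disjoint union being $(n/d)H_d$).
   Context: Directed graphs are finite, may have loops and directed cycles of length two, but have no parallel edges (for each ordered pair $(u,v)$, possibly with $u=v$, there is at most one edge $u\to v$). A loop contributes one to both the in-degree and the out-degree of its vertex. A directed graph is $d$-regular if every vertex has in-degree and out-degree exactly $d$. A cycle-factor of a directed graph $G$ is a permutation $\sigma$ of $V(G)$ such that $v\to\sigma(v)$ is an edge of $G$ for every $v\in V(G)$. $\mathcal{C}(G)$ denotes the set of cycle-factors of $G$, and $c(\sigma)$ is the number of cycles of the permutation $\sigma$, fixed points included. $K_d^\circ$ is the complete looped digraph on $d$ vertices: all ordered pairs $(u,v)$, including $u=v$, are edges. $H_m=\sum_{j=1}^m \frac1j$ is the $m$-th harmonic number. Random cycle-factors are chosen uniformly from the finite set $\mathcal{C}(G)$. *)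

theory Defs
  imports
    "HOL-Probability.Probability"
    "HOL-Combinatorics.Orbits"
    "Graph_Theory.Graph_Theory"
begin

text \<open>
  Directed graphs are the \<open>pair_fin_digraph\<close>s of \<open>Graph_Theory\<close>: finite, loops and
  two-cycles allowed, and no parallel arcs because arcs are ordered pairs of vertices.
\<close>

definition regular_digraph :: "nat \<Rightarrow> 'a pair_pre_digraph \<Rightarrow> bool" where
  "regular_digraph d G \<longleftrightarrow> pair_fin_digraph G \<and>
     (\<forall>v\<in>pverts G. in_degree (with_proj G) v = d \<and> out_degree (with_proj G) v = d)"

definition cycle_factors :: "'a pair_pre_digraph \<Rightarrow> ('a \<Rightarrow> 'a) set" where
  "cycle_factors G = {\<sigma>. \<sigma> permutes pverts G \<and> (\<forall>v\<in>pverts G. (v, \<sigma> v) \<in> parcs G)}"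

text \<open>
  The cycles of a permutation of \<open>V\<close> are its orbits on \<open>V\<close>; a fixed point \<open>v\<close> contributes
  the orbit \<open>{v}\<close>.
\<close>

definition num_cycles :: "'a set \<Rightarrow> ('a \<Rightarrow> 'a) \<Rightarrow> nat" where
  "num_cycles V \<sigma> = card (orbit \<sigma> ` V)"

text \<open>
  \<open>pmf_of_set\<close> is only meaningful on finite nonempty sets. A \<open>d\<close>-regular digraph with
  \<open>d \<ge> 1\<close> always has a cycle-factor (by Hall's theorem), so this is no restriction there.
\<close>

definition expected_cycles :: "'a pair_pre_digraph \<Rightarrow> real" where
  "expected_cycles G =
     measure_pmf.expectation (pmf_of_set (cycle_factors G)) (\<lambda>\<sigma>. real (num_cycles (pverts G) \<sigma>))"

definition complete_looped :: "'a set \<Rightarrow> 'a pair_pre_digraph" where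
  "complete_looped S = \<lparr>pverts = S, parcs = S \<times> S\<rparr>"

text \<open>
  The disjoint union of \<open>m\<close> copies of the complete looped digraph on \<open>d\<close> vertices, the
  \<open>i\<close>-th copy living on the block \<open>{i * d..<(i + 1) * d}\<close>.
\<close>

definition complete_looped_copies :: "nat \<Rightarrow> nat \<Rightarrow> nat pair_pre_digraph" where
  "complete_looped_copies m d =
     \<lparr>pverts = (\<Union>i<m. pverts (complete_looped {i * d..<(i + 1) * d})),
      parcs = (\<Union>i<m. parcs (complete_looped {i * d..<(i + 1) * d}))\<rparr>"

text \<open>
  Every finite digraph is isomorphic to one with vertices in \<open>nat\<close>, and uniqueness of the
  maximiser is up to isomorphism. That the maximiser itself belongs to the class is
  the lemma \<open>complete_looped_copies_regular\<close> below.
\<close>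

definition complete_copies_uniquely_maximise :: "nat \<Rightarrow> nat \<Rightarrow> bool" where
  "complete_copies_uniquely_maximise d n \<longleftrightarrow>
     (\<forall>G :: nat pair_pre_digraph. regular_digraph d G \<and> card (pverts G) = n \<longrightarrow>
        expected_cycles G \<le> expected_cycles (complete_looped_copies (n div d) d) \<and>
        (expected_cycles G = expected_cycles (complete_looped_copies (n div d) d) \<longrightarrow>
           digraph_iso (with_proj G) (with_proj (complete_looped_copies (n div d) d))))"

lemma block_iff:
  assumes "0 < d"
  shows "(v::nat) \<in> {i * d..<(i + 1) * d} \<longleftrightarrow> v div d = i"
proof -
  have "i \<le> v div d \<longleftrightarrow> i * d \<le> v"
    using assms by (rule less_eq_div_iff_mult_less_eq)
  moreover have "v div d < i + 1 \<longleftrightarrow> v < (i + 1) * d"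
    using assms by (rule div_less_iff_less_mult)
  ultimately show ?thesis
    unfolding atLeastLessThan_iff by linarith
qed

lemma complete_looped_copies_regular:
  assumes "0 < d"
  shows "regular_digraph d (complete_looped_copies m d)"
    and "card (pverts (complete_looped_copies m d)) = m * d"
proof -
  let ?G = "complete_looped_copies m d"
  have lt: "u div d < m \<longleftrightarrow> u < m * d" for u
    using assms by (rule div_less_iff_less_mult)
  have V': "u \<in> pverts ?G \<longleftrightarrow> u div d < m" for u
    unfolding complete_looped_copies_def complete_looped_def pair_pre_digraph.select_convs
      UN_iff block_iff[OF assms] by blast
  have V: "pverts ?G = {..<m * d}"
    using V' lt by blast
  have A: "(u, v) \<in> parcs ?G \<longleftrightarrow> u div d < m \<and> u div d = v div d" for u v
    unfolding complete_looped_copies_def complete_looped_def pair_pre_digraph.select_convs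
      UN_iff mem_Sigma_iff block_iff[OF assms] by auto
  show "card (pverts ?G) = m * d"
    by (simp add: V)
  have sub: "parcs ?G \<subseteq> pverts ?G \<times> pverts ?G"
  proof
    fix e assume "e \<in> parcs ?G"
    then show "e \<in> pverts ?G \<times> pverts ?G"
      by (cases e) (simp add: A V')
  qed
  have fin: "finite (pverts ?G)"
    by (simp add: V)
  have "pair_fin_digraph ?G"
  proof
    show "finite (parcs ?G)"
      using sub fin by (meson finite_SigmaI finite_subset)
    show "finite (pverts ?G)" by (rule fin)
    show "fst e \<in> pverts ?G" if "e \<in> parcs ?G" for e
      using sub that by (metis mem_Times_iff subsetD)
    show "snd e \<in> pverts ?G" if "e \<in> parcs ?G" for e
      using sub that by (metis mem_Times_iff subsetD)
  qed
  moreover have "in_degree (with_proj ?G) v = d \<and> out_degree (with_proj ?G) v = d"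
    if "v \<in> pverts ?G" for v
  proof -
    let ?B = "{(v div d) * d..<(v div d + 1) * d}"
    have v: "v div d < m"
      using that V' by blast
    have "(u, w) \<in> in_arcs (with_proj ?G) v \<longleftrightarrow> w = v \<and> u \<in> ?B" for u w
      using v unfolding block_iff[OF assms] in_in_arcs_conv with_proj_simps A by auto
    then have "in_arcs (with_proj ?G) v = ?B \<times> {v}"
      by (simp only: set_eq_iff split_paired_All mem_Sigma_iff singleton_iff) blast
    moreover
    have "(u, w) \<in> out_arcs (with_proj ?G) v \<longleftrightarrow> u = v \<and> w \<in> ?B" for u w
      using v unfolding block_iff[OF assms] in_out_arcs_conv with_proj_simps A by auto
    then have "out_arcs (with_proj ?G) v = {v} \<times> ?B"
      by (simp only: set_eq_iff split_paired_All mem_Sigma_iff singleton_iff) blast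
    ultimately show ?thesis
      by (simp add: in_degree_def out_degree_def card_cartesian_product)
  qed
  ultimately show "regular_digraph d ?G"
    by (simp add: regular_digraph_def)
qed

end

theory Submission
  imports Defs
begin

text \<open>
  The counterexample is a small switch between two complete blocks. Let \<open>B\<close> and \<open>C\<close> be two
  complete looped blocks on \<open>d\<close> vertices, pick two vertices \<open>a, b\<close> of \<open>B\<close> and \<open>a', b'\<close> of \<open>C\<close>,
  delete the undirected edges \<open>ab\<close> and \<open>a'b'\<close> and insert \<open>aa'\<close> and \<open>bb'\<close> instead (each undirected
  edge being a pair of opposite arcs). The result is still \<open>d\<close>-regular; for \<open>d = 3\<close> it is the
  six-cycle with a loop at every vertex. Forbidding arcs that are not loops raises the mean number
  of cycles of a permutation of one block. The new arcs let in factors that cross between the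
  blocks; some of them have few cycles, but their loss is smaller than the gain once \<open>d \<ge> 3\<close>.

  To make this exact, write \<open>h\<close> for twice the mean \<open>harm d\<close> of one complete block and sum
  \<open>c(\<sigma>) - h\<close> over the cycle-factors \<open>\<sigma>\<close> (\<open>cycle_excess\<close>); the expectation exceeds \<open>h\<close> iff the sum
  is positive. As many arcs of \<open>\<sigma>\<close> lead from \<open>B\<close> to \<open>C\<close> as back, so only six of the sixteen
  subsets of the four crossing arcs can occur in \<open>\<sigma>\<close>. Each of the six classes arises
  from a set of products of a permutation of \<open>B\<close> and a permutation of \<open>C\<close>, with prescribed or forbidden
  values at \<open>a, b, a', b'\<close>, by composing with zero, one or two transpositions that exchange a
  vertex of \<open>B\<close> with one of \<open>C\<close>. Composing with a transposition of two points in
  different cycles merges these cycles (\<open>num_cycles_merge\<close>), so it lowers the cycle number by one. The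
  same fact gives all the sums inside one block, including the mean \<open>harm d\<close> itself. With \<open>d = n + 2\<close>
  the total excess is
  \<open>(n!)^2 (6 n^4 + 8 n^3 + 10 n^2 + 16 n) / ((n + 1) (n + 2))\<close> (\<open>cycle_excess_switched\<close>), which is
  positive for \<open>n \<ge> 1\<close> and vanishes for \<open>d = 2\<close>.

  For \<open>k\<close> blocks, add \<open>k - 2\<close> untouched complete blocks: expected cycle numbers add over disjoint
  unions (\<open>expected_cycles_digraph_union\<close>).
\<close>

section \<open>Cycles under composition\<close>

lemma orbit_comp_disjoint:
  assumes "\<sigma> permutes B" "\<tau> permutes C" "B \<inter> C = {}"
  shows "x \<in> B \<Longrightarrow> orbit (\<sigma> \<circ> \<tau>) x = orbit \<sigma> x"
    and "x \<in> C \<Longrightarrow> orbit (\<sigma> \<circ> \<tau>) x = orbit \<tau> x"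
proof -
  have B: "(\<sigma> \<circ> \<tau>) y = \<sigma> y" if "y \<in> B" for y
    using that assms by (auto simp: permutes_def)
  have C: "(\<sigma> \<circ> \<tau>) y = \<tau> y" if "y \<in> C" for y
    using that assms permutes_in_image[OF assms(2), of y] by (auto simp: permutes_def)
  show "orbit (\<sigma> \<circ> \<tau>) x = orbit \<sigma> x" if "x \<in> B"
    using that assms(1) by (intro orbit_cong0[symmetric, of x B]) (auto simp: permutes_in_image B[unfolded o_def])
  show "orbit (\<sigma> \<circ> \<tau>) x = orbit \<tau> x" if "x \<in> C"
    using that assms(2) by (intro orbit_cong0[symmetric, of x C]) (auto simp: permutes_in_image C[unfolded o_def])
qed

lemma num_cycles_comp_disjoint:
  assumes "\<sigma> permutes B" "\<tau> permutes C" "B \<inter> C = {}" "finite B" "finite C"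
  shows "num_cycles (B \<union> C) (\<sigma> \<circ> \<tau>) = num_cycles B \<sigma> + num_cycles C \<tau>"
proof -
  have "orbit (\<sigma> \<circ> \<tau>) ` (B \<union> C) = orbit \<sigma> ` B \<union> orbit \<tau> ` C"
    using orbit_comp_disjoint[OF assms(1-3)] by (auto simp: image_Un)
  moreover have "orbit \<sigma> ` B \<inter> orbit \<tau> ` C = {}"
  proof -
    have "orbit \<sigma> x \<noteq> orbit \<tau> y" if "x \<in> B" "y \<in> C" for x y
      using permutes_orbit_subset[OF assms(1) that(1)] permutes_orbit_subset[OF assms(2) that(2)]
        assms(3) orbit_nonempty[of \<sigma> x] by blast
    then show ?thesis by blast
  qed
  ultimately show ?thesis
    using assms(4,5) by (simp add: num_cycles_def card_Un_disjoint)
qed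

text \<open>
  Following \<open>\<sigma> \<circ> transpose a b\<close> from \<open>a\<close> first traverses the whole old cycle of \<open>b\<close>: the start jumps
  to \<open>\<sigma> b\<close>, and nothing changes until \<open>b\<close> is reached.
\<close>

lemma orbit_subset_of_transpose:
  assumes "b \<in> orbit \<sigma> b" "a \<notin> orbit \<sigma> b"
  shows "orbit \<sigma> b \<subseteq> orbit (\<sigma> \<circ> Transposition.transpose a b) a"
proof
  let ?\<rho> = "\<sigma> \<circ> Transposition.transpose a b"
  have a: "?\<rho> a = \<sigma> b" by simp
  fix x assume "x \<in> orbit \<sigma> b"
  then show "x \<in> orbit ?\<rho> a"
  proof induction
    case base
    show ?case using orbit.base[of ?\<rho> a] by (simp only: a)
  next
    case (step y)
    then have "y \<noteq> a" using assms(2) by blast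
    show ?case
    proof (cases "y = b")
      case True
      then show ?thesis using orbit.base[of ?\<rho> a] by (simp only: a)
    next
      case False
      then have "?\<rho> y = \<sigma> y" using \<open>y \<noteq> a\<close> by (simp add: Transposition.transpose_def)
      then show ?thesis using orbit.step[OF step.IH] by (simp only:)
    qed
  qed
qed

text \<open>
  The new cycle of \<open>a\<close> contains both old cycles by \<open>orbit_subset_of_transpose\<close>, applied in both
  directions, and it cannot leave their union, which is closed under the new permutation. All other
  cycles are untouched.
\<close>

lemma num_cycles_merge:
  assumes "finite V" "\<sigma> permutes V" "a \<in> V" "b \<in> V" "b \<notin> orbit \<sigma> a"
  shows "num_cycles V \<sigma> = Suc (num_cycles V (\<sigma> \<circ> Transposition.transpose a b))"
proof -
  define \<rho> where "\<rho> = \<sigma> \<circ> Transposition.transpose a b"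
  define U where "U = orbit \<sigma> a \<union> orbit \<sigma> b"
  have \<rho>: "\<rho> permutes V"
    unfolding \<rho>_def using assms by (intro permutes_compose permutes_swap_id)
  have self: "x \<in> orbit \<sigma> x" "x \<in> orbit \<rho> x" for x
    using assms(1,2) \<rho> by (auto intro!: permutation_self_in_orbit simp: permutation_permutes)
  have eqI: "orbit f y = orbit f x" if "f permutes V" "y \<in> orbit f x" for f x y
    using orbit_cyclic_eq3[OF cyclic_on_orbit[OF that(1) assms(1)] that(2)] .
  have ba: "a \<notin> orbit \<sigma> b"
    using eqI[OF assms(2), of a b] self(1)[of b] assms(5) by blast
  have "orbit \<sigma> b \<subseteq> orbit \<rho> a"
    unfolding \<rho>_def using orbit_subset_of_transpose[OF self(1) ba] .
  moreover have "orbit \<sigma> a \<subseteq> orbit \<rho> b"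
    unfolding \<rho>_def using orbit_subset_of_transpose[OF self(1) assms(5)]
    by (simp add: transpose_commute)
  moreover have "orbit \<rho> b = orbit \<rho> a"
    using calculation(1) self(1)[of b] eqI[OF \<rho>] by blast
  ultimately have sub: "U \<subseteq> orbit \<rho> a" by (simp add: U_def)
  have Uin: "x \<in> U \<longleftrightarrow> orbit \<sigma> x = orbit \<sigma> a \<or> orbit \<sigma> x = orbit \<sigma> b" for x
    unfolding U_def using eqI[OF assms(2)] self(1) by blast
  have Ustep: "\<rho> x \<in> U" if "x \<in> U" for x
    using that by (cases "x = a"; cases "x = b") (auto simp: U_def \<rho>_def intro: orbit.intros)
  have aU: "a \<in> U" using self(1) by (simp add: U_def)
  have "x \<in> U" if "x \<in> orbit \<rho> a" for x
    using that by induction (use aU Ustep in auto)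
  with sub have orb_a: "orbit \<rho> a = U" by blast
  have in_U: "orbit \<rho> x = U" if "x \<in> U" for x
    using eqI[OF \<rho>, of x a] that orb_a by simp
  have out_U: "orbit \<rho> x = orbit \<sigma> x" if "x \<notin> U" for x
  proof (rule orbit_cong[OF self(1)])
    fix s assume "s \<in> orbit \<sigma> x"
    then have "orbit \<sigma> s = orbit \<sigma> x" by (rule eqI[OF assms(2)])
    then have "s \<notin> U" using that Uin by auto
    then have "s \<noteq> a" "s \<noteq> b" using self(1) by (auto simp: U_def)
    then show "\<rho> s = \<sigma> s" by (simp add: \<rho>_def)
  qed
  let ?R = "orbit \<sigma> ` (V - U)"
  have UV: "U \<subseteq> V"
    unfolding U_def using permutes_orbit_subset[OF assms(2)] assms(3,4) by blast
  have "orbit \<rho> ` V = orbit \<rho> ` U \<union> orbit \<rho> ` (V - U)"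
    using UV by blast
  also have "orbit \<rho> ` U = {U}"
    using in_U aU by auto
  also have "orbit \<rho> ` (V - U) = ?R"
    using out_U by (intro image_cong) auto
  finally have "orbit \<rho> ` V = insert U ?R" by simp
  moreover have "orbit \<sigma> ` V = insert (orbit \<sigma> a) (insert (orbit \<sigma> b) ?R)"
  proof
    show "orbit \<sigma> ` V \<subseteq> insert (orbit \<sigma> a) (insert (orbit \<sigma> b) ?R)"
      using Uin by blast
    show "insert (orbit \<sigma> a) (insert (orbit \<sigma> b) ?R) \<subseteq> orbit \<sigma> ` V"
      using assms(3,4) by blast
  qed
  moreover have "orbit \<sigma> a \<notin> ?R" "orbit \<sigma> b \<notin> ?R"
    using Uin by auto
  moreover have "U \<notin> ?R"
  proof
    assume "U \<in> ?R"
    then obtain x where "x \<notin> U" "U = orbit \<sigma> x" by blast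
    then show False using self(1)[of x] by simp
  qed
  moreover have "orbit \<sigma> a \<noteq> orbit \<sigma> b"
    using self(1)[of b] assms(5) by auto
  ultimately show ?thesis
    using assms(1) by (simp add: num_cycles_def flip: \<rho>_def)
qed

section \<open>Summed cycle excess\<close>

text \<open>
  Subtracting the reference value \<open>h\<close> in every summand makes one quantity out of the cycle sum and
  the cardinality of \<open>P\<close>; it is additive over disjoint unions of classes, unlike the mean.
\<close>

definition cycle_excess :: "'a set \<Rightarrow> real \<Rightarrow> ('a \<Rightarrow> 'a) set \<Rightarrow> real" where
  "cycle_excess V h P = (\<Sum>\<sigma>\<in>P. real (num_cycles V \<sigma>) - h)"

definition block_products :: "('a \<Rightarrow> 'a) set \<Rightarrow> ('a \<Rightarrow> 'a) set \<Rightarrow> ('a \<Rightarrow> 'a) set" where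
  "block_products P Q = (\<lambda>(\<sigma>, \<tau>). \<sigma> \<circ> \<tau>) ` (P \<times> Q)"

lemma perm_restrict_comp_disjoint:
  assumes "\<sigma> permutes B" "\<tau> permutes C" "B \<inter> C = {}"
  shows "perm_restrict (\<sigma> \<circ> \<tau>) B = \<sigma>" and "perm_restrict (\<sigma> \<circ> \<tau>) C = \<tau>"
proof -
  have "\<tau> x = x" if "x \<in> B" for x
    using that assms by (auto simp: permutes_def)
  then show "perm_restrict (\<sigma> \<circ> \<tau>) B = \<sigma>"
    using assms(1) by (auto simp: fun_eq_iff perm_restrict_def permutes_def)
  have "\<sigma> (\<tau> x) = \<tau> x" if "x \<in> C" for x
    using that assms permutes_in_image[OF assms(2), of x] by (auto simp: permutes_def)
  then show "perm_restrict (\<sigma> \<circ> \<tau>) C = \<tau>"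
    using assms(2) by (auto simp: fun_eq_iff perm_restrict_def permutes_def)
qed

lemma inj_on_block_products:
  assumes "B \<inter> C = {}" "\<And>\<sigma>. \<sigma> \<in> P \<Longrightarrow> \<sigma> permutes B" "\<And>\<tau>. \<tau> \<in> Q \<Longrightarrow> \<tau> permutes C"
  shows "inj_on (\<lambda>(\<sigma>, \<tau>). \<sigma> \<circ> \<tau>) (P \<times> Q)"
proof (rule inj_onI, clarify)
  fix \<sigma> \<tau> \<sigma>' \<tau>' assume h: "\<sigma> \<in> P" "\<tau> \<in> Q" "\<sigma>' \<in> P" "\<tau>' \<in> Q" "\<sigma> \<circ> \<tau> = \<sigma>' \<circ> \<tau>'"
  show "\<sigma> = \<sigma>' \<and> \<tau> = \<tau>'"
    using perm_restrict_comp_disjoint[OF assms(2)[OF h(1)] assms(3)[OF h(2)] assms(1)]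
      perm_restrict_comp_disjoint[OF assms(2)[OF h(3)] assms(3)[OF h(4)] assms(1)] h(5) by simp
qed

lemma card_block_products:
  assumes "B \<inter> C = {}" "\<And>\<sigma>. \<sigma> \<in> P \<Longrightarrow> \<sigma> permutes B" "\<And>\<tau>. \<tau> \<in> Q \<Longrightarrow> \<tau> permutes C"
  shows "card (block_products P Q) = card P * card Q"
  unfolding block_products_def
  using card_image[OF inj_on_block_products[OF assms]] by (simp add: card_cartesian_product)

text \<open>
  Cycle numbers add under the product, so the two reference values may be split off separately.
\<close>

lemma cycle_excess_block_products:
  assumes "B \<inter> C = {}" "\<And>\<sigma>. \<sigma> \<in> P \<Longrightarrow> \<sigma> permutes B" "\<And>\<tau>. \<tau> \<in> Q \<Longrightarrow> \<tau> permutes C"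
    and "finite B" "finite C"
  shows "cycle_excess (B \<union> C) (h + h') (block_products P Q) =
    real (card Q) * cycle_excess B h P + real (card P) * cycle_excess C h' Q"
proof -
  have "cycle_excess (B \<union> C) (h + h') (block_products P Q) =
      (\<Sum>(\<sigma>, \<tau>)\<in>P \<times> Q. real (num_cycles (B \<union> C) (\<sigma> \<circ> \<tau>)) - (h + h'))"
    unfolding cycle_excess_def block_products_def
    by (subst sum.reindex[OF inj_on_block_products[OF assms(1-3)]]) (auto intro: sum.cong)
  also have "\<dots> = (\<Sum>(\<sigma>, \<tau>)\<in>P \<times> Q. (real (num_cycles B \<sigma>) - h) + (real (num_cycles C \<tau>) - h'))"
    using assms by (intro sum.cong) (auto simp: num_cycles_comp_disjoint)
  also have "\<dots> = (\<Sum>\<sigma>\<in>P. \<Sum>\<tau>\<in>Q. (real (num_cycles B \<sigma>) - h) + (real (num_cycles C \<tau>) - h'))"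
    by (simp add: sum.cartesian_product)
  also have "\<dots> = real (card Q) * cycle_excess B h P + real (card P) * cycle_excess C h' Q"
    by (simp add: cycle_excess_def sum.distrib sum_distrib_left sum_subtractf algebra_simps)
  finally show ?thesis .
qed

text \<open>
  This turns membership in a product class into pointwise conditions on a single permutation, which
  is the form in which cycle-factors are given. The conditions \<open>\<phi>\<close> and \<open>\<psi>\<close> stay arbitrary so that
  the lemma covers both prescribed values and arc conditions.
\<close>

lemma mem_block_products_iff:
  assumes "B \<inter> C = {}"
  shows "\<rho> \<in> block_products {\<sigma>. \<sigma> permutes B \<and> \<phi> \<sigma>} {\<tau>. \<tau> permutes C \<and> \<psi> \<tau>} \<longleftrightarrow>
    \<rho> permutes B \<union> C \<and> (\<forall>x\<in>B. \<rho> x \<in> B) \<and> (\<forall>x\<in>C. \<rho> x \<in> C) \<and>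
    \<phi> (perm_restrict \<rho> B) \<and> \<psi> (perm_restrict \<rho> C)"
    (is "?L \<longleftrightarrow> ?R")
proof
  assume ?L
  then obtain q where q: "q \<in> {\<sigma>. \<sigma> permutes B \<and> \<phi> \<sigma>} \<times> {\<tau>. \<tau> permutes C \<and> \<psi> \<tau>}"
      "\<rho> = (case q of (\<sigma>, \<tau>) \<Rightarrow> \<sigma> \<circ> \<tau>)"
    unfolding block_products_def by (rule imageE)
  obtain \<sigma> \<tau> where "q = (\<sigma>, \<tau>)" by (cases q)
  with q have *: "\<rho> = \<sigma> \<circ> \<tau>" "\<sigma> permutes B" "\<phi> \<sigma>" "\<tau> permutes C" "\<psi> \<tau>"
    by simp_all
  have "\<rho> permutes B \<union> C"
    unfolding *(1) using permutes_subset[OF *(2), of "B \<union> C"] permutes_subset[OF *(4), of "B \<union> C"]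
    by (intro permutes_compose) simp_all
  moreover have "\<rho> x \<in> B" if "x \<in> B" for x
    using that * assms permutes_in_image[OF *(2), of x] permutes_not_in[OF *(4), of x]
    by (auto simp: disjoint_iff)
  moreover have "\<rho> x \<in> C" if "x \<in> C" for x
  proof -
    have "\<tau> x \<in> C" using that permutes_in_image[OF *(4)] by simp
    moreover from this have "\<sigma> (\<tau> x) = \<tau> x"
      using assms permutes_not_in[OF *(2)] by blast
    ultimately show ?thesis using *(1) by simp
  qed
  moreover note perm_restrict_comp_disjoint[OF *(2,4) assms]
  ultimately show ?R using *(3,5) unfolding *(1) by (intro conjI ballI) simp_all
next
  assume R: ?R
  have inj: "inj \<rho>" by (rule permutes_inj[OF conjunct1[OF R]])
  have sur: "\<exists>x\<in>D. \<rho> x = y" if "y \<in> D" "D = B \<or> D = C" for y D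
  proof -
    have "y \<in> \<rho> ` (B \<union> C)"
      using that unfolding permutes_image[OF conjunct1[OF R]] by blast
    then obtain x where "x \<in> B \<union> C" "\<rho> x = y" by blast
    moreover have "x \<in> B \<Longrightarrow> \<rho> x \<in> B" "x \<in> C \<Longrightarrow> \<rho> x \<in> C" using R by blast+
    ultimately show ?thesis using that assms by blast
  qed
  have "perm_restrict \<rho> D permutes D" if "D = B \<or> D = C" for D
  proof (rule bij_imp_permutes)
    have "\<rho> x \<in> D" if "x \<in> D" for x
      using R that \<open>D = B \<or> D = C\<close> by auto
    with sur[OF _ that] have "\<rho> ` D = D" by blast
    then have "bij_betw \<rho> D D"
      using inj_on_subset[OF inj subset_UNIV] by (simp add: bij_betw_def)
    then show "bij_betw (perm_restrict \<rho> D) D D"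
      using bij_betw_cong[of D "perm_restrict \<rho> D" \<rho> D] by (simp add: perm_restrict_simps)
  qed (simp add: perm_restrict_def)
  note p = this[OF disjI1[OF refl]] this[OF disjI2[OF refl]]
  have "perm_restrict \<rho> B \<circ> perm_restrict \<rho> C = \<rho>"
    using perm_restrict_union[OF p assms] R by simp
  moreover have "perm_restrict \<rho> B \<circ> perm_restrict \<rho> C \<in> block_products
      {\<sigma>. \<sigma> permutes B \<and> \<phi> \<sigma>} {\<tau>. \<tau> permutes C \<and> \<psi> \<tau>}"
    unfolding block_products_def
    by (rule image_eqI[where x = "(perm_restrict \<rho> B, perm_restrict \<rho> C)"]) (use p R in simp_all)
  ultimately show ?L by (simp only:)
qed

lemma comp_transpose_twice:
  "\<sigma> \<circ> Transposition.transpose a b \<circ> Transposition.transpose a b = \<sigma>"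
  by (simp add: comp_assoc)

lemma inj_on_comp_transpose: "inj_on (\<lambda>\<rho>. \<rho> \<circ> Transposition.transpose a b) P"
  by (rule inj_on_inverseI[where g = "\<lambda>\<rho>. \<rho> \<circ> Transposition.transpose a b"])
    (rule comp_transpose_twice)

lemma mem_comp_transpose_iff:
  "\<sigma> \<in> (\<lambda>\<rho>. \<rho> \<circ> Transposition.transpose a b) ` P \<longleftrightarrow> \<sigma> \<circ> Transposition.transpose a b \<in> P"
proof
  assume "\<sigma> \<in> (\<lambda>\<rho>. \<rho> \<circ> Transposition.transpose a b) ` P"
  then show "\<sigma> \<circ> Transposition.transpose a b \<in> P"
    by (auto simp only: comp_transpose_twice)
next
  assume "\<sigma> \<circ> Transposition.transpose a b \<in> P"
  then show "\<sigma> \<in> (\<lambda>\<rho>. \<rho> \<circ> Transposition.transpose a b) ` P"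
    by (intro image_eqI[where x = "\<sigma> \<circ> Transposition.transpose a b"])
      (simp_all only: comp_transpose_twice)
qed

lemma card_comp_transpose: "card ((\<lambda>\<rho>. \<rho> \<circ> Transposition.transpose a b) ` P) = card P"
  by (rule card_image[OF inj_on_comp_transpose])

lemma cycle_excess_merge:
  assumes "finite V" "a \<in> V" "b \<in> V"
    and "\<And>\<rho>. \<rho> \<in> P \<Longrightarrow> \<rho> permutes V \<and> b \<notin> orbit \<rho> a"
  shows "cycle_excess V h ((\<lambda>\<rho>. \<rho> \<circ> Transposition.transpose a b) ` P) = cycle_excess V h P - real (card P)"
proof -
  have "cycle_excess V h ((\<lambda>\<rho>. \<rho> \<circ> Transposition.transpose a b) ` P) =
      (\<Sum>\<rho>\<in>P. real (num_cycles V (\<rho> \<circ> Transposition.transpose a b)) - h)"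
    unfolding cycle_excess_def by (subst sum.reindex[OF inj_on_comp_transpose]) simp
  also have "\<dots> = (\<Sum>\<rho>\<in>P. (real (num_cycles V \<rho>) - h) - 1)"
    using assms by (intro sum.cong) (auto simp: num_cycles_merge)
  finally show ?thesis by (simp add: cycle_excess_def sum_subtractf)
qed

lemma cycle_excess_union_disjoint:
  assumes "finite P" "finite Q" "P \<inter> Q = {}"
  shows "cycle_excess V h (P \<union> Q) = cycle_excess V h P + cycle_excess V h Q"
  using assms by (simp add: cycle_excess_def sum.union_disjoint)

section \<open>Permutations of one block with prescribed values\<close>

lemma permutes_fixing_iff: "\<sigma> permutes V \<and> \<sigma> a = a \<longleftrightarrow> \<sigma> permutes V - {a}"
  using permutes_superset[of \<sigma> V "V - {a}"] permutes_subset[of \<sigma> "V - {a}" V]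
    permutes_not_in[of \<sigma> "V - {a}" a] by blast

lemma cycle_excess_insert_fixed:
  assumes "finite S" "a \<notin> S" "\<And>\<sigma>. \<sigma> \<in> P \<Longrightarrow> \<sigma> permutes S"
  shows "cycle_excess (insert a S) h P = cycle_excess S (h - 1) P"
  unfolding cycle_excess_def
proof (rule sum.cong)
  fix \<sigma> assume "\<sigma> \<in> P"
  then have "num_cycles ({a} \<union> S) (id \<circ> \<sigma>) = num_cycles {a} id + num_cycles S \<sigma>"
    using assms by (intro num_cycles_comp_disjoint) auto
  moreover have "num_cycles {a} id = 1" by (simp add: num_cycles_def)
  ultimately show "real (num_cycles (insert a S) \<sigma>) - h = real (num_cycles S \<sigma>) - (h - 1)"
    by simp
qed simp

lemma permutes_comp_transpose_iff:
  assumes "a \<in> V" "b \<in> V"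
  shows "\<sigma> \<circ> Transposition.transpose a b permutes V \<longleftrightarrow> \<sigma> permutes V"
  using permutes_compose[OF permutes_swap_id[OF assms], of \<sigma>]
    permutes_compose[OF permutes_swap_id[OF assms], of "\<sigma> \<circ> Transposition.transpose a b"]
  by (auto simp only: comp_transpose_twice)

text \<open>
  A permutation through the arc from \<open>b\<close> to \<open>a\<close> is one that fixes \<open>a\<close>, with \<open>a\<close> afterwards inserted
  into the cycle of \<open>b\<close>.
\<close>

lemma permutes_arc_eq_merge:
  assumes "a \<in> V" "b \<in> V"
  shows "{\<sigma>. \<sigma> permutes V \<and> \<sigma> b = a} =
    (\<lambda>\<rho>. \<rho> \<circ> Transposition.transpose a b) ` {\<sigma>. \<sigma> permutes V \<and> \<sigma> a = a}"
  by (rule set_eqI)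
    (simp only: mem_comp_transpose_iff mem_Collect_eq permutes_comp_transpose_iff[OF assms], simp)

lemma permutes_swap_eq_merge:
  assumes "a \<in> V" "b \<in> V"
  shows "{\<sigma>. \<sigma> permutes V \<and> \<sigma> b = a \<and> \<sigma> a = b} =
    (\<lambda>\<rho>. \<rho> \<circ> Transposition.transpose a b) ` {\<sigma>. \<sigma> permutes V \<and> \<sigma> a = a \<and> \<sigma> b = b}"
  by (rule set_eqI)
    (simp only: mem_comp_transpose_iff mem_Collect_eq permutes_comp_transpose_iff[OF assms], simp)

lemma orbit_fixed: "\<sigma> a = a \<Longrightarrow> orbit \<sigma> a = {a}"
  by (simp add: orbit_eq_singleton_iff)

text \<open>
  The mean number of cycles of a permutation of \<open>V\<close> is \<open>harm (card V)\<close>. In the induction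
  step the permutations are sorted by the preimage \<open>b\<close> of the new point \<open>a\<close>: for \<open>b = a\<close> there is one
  extra cycle, and for each other \<open>b\<close> the class is obtained from that one by merging, which
  cancels the extra cycle.
\<close>

lemma cycle_excess_permutations:
  assumes "finite V"
  shows "cycle_excess V h {\<sigma>. \<sigma> permutes V} = fact (card V) * (harm (card V) - h)"
  using assms
proof (induction V arbitrary: h)
  case empty
  have "{\<sigma>. \<sigma> permutes {}} = {id}" by auto
  then show ?case by (simp add: cycle_excess_def num_cycles_def harm_def)
next
  case (insert a S)
  let ?V = "insert a S" and ?n = "card S"
  let ?F = "\<lambda>b. {\<sigma>. \<sigma> permutes ?V \<and> \<sigma> b = a}"
  have fix_eq: "?F a = {\<sigma>. \<sigma> permutes S}"
    using insert.hyps permutes_fixing_iff[of _ ?V a] by auto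
  have card_fix: "card (?F a) = fact ?n"
    using fix_eq card_permutations[OF refl insert.hyps(1)] by simp
  have fix_exc: "cycle_excess ?V h (?F a) = fact ?n * (harm ?n + 1 - h)" for h
    unfolding fix_eq using insert by (subst cycle_excess_insert_fixed) auto
  have arc: "cycle_excess ?V h (?F b) = fact ?n * (harm ?n - h)" if "b \<in> S" for b
  proof -
    have "b \<noteq> a" using that insert.hyps by auto
    then have "cycle_excess ?V h (?F b) = cycle_excess ?V h (?F a) - card (?F a)"
      using that insert.hyps(1)
      by (subst permutes_arc_eq_merge[of a ?V b], simp, simp)
        (rule cycle_excess_merge, auto simp: orbit_fixed)
    then show ?thesis by (simp add: fix_exc card_fix algebra_simps)
  qed
  have part: "{\<sigma>. \<sigma> permutes ?V} = (\<Union>b\<in>?V. ?F b)"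
  proof -
    have "\<exists>b\<in>?V. \<sigma> b = a" if "\<sigma> permutes ?V" for \<sigma>
      using permutes_image[OF that] by (metis imageE insertI1)
    then show ?thesis by blast
  qed
  have "finite (?F b)" for b
    using finite_permutations[of ?V] insert.hyps(1) by simp
  then have "cycle_excess ?V h {\<sigma>. \<sigma> permutes ?V} = (\<Sum>b\<in>?V. cycle_excess ?V h (?F b))"
    unfolding part cycle_excess_def using insert.hyps(1)
    by (intro sum.UNION_disjoint) (auto dest!: permutes_inj dest: injD)
  also have "\<dots> = fact ?n * (harm ?n + 1 - h) + ?n * (fact ?n * (harm ?n - h))"
    using insert.hyps fix_exc arc by simp
  also have "\<dots> = fact (Suc ?n) * (harm (Suc ?n) - h)"
    by (simp add: harm_Suc field_simps)
  finally show ?case using insert.hyps by simp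
qed


context
  fixes V :: "'a set" and a b :: 'a and n :: nat
  assumes fin: "finite V" and card_V: "card V = Suc (Suc n)"
    and a: "a \<in> V" and b: "b \<in> V" and ab: "a \<noteq> b"
begin

lemma finite_perms: "finite {\<sigma>. \<sigma> permutes V \<and> \<phi> \<sigma>}"
  using finite_permutations[OF fin] by simp

lemma fixing:
  "card {\<sigma>. \<sigma> permutes V \<and> \<sigma> a = a} = fact (Suc n)"
  "cycle_excess V h {\<sigma>. \<sigma> permutes V \<and> \<sigma> a = a} = fact (Suc n) * (harm (Suc n) + 1 - h)"
proof -
  have V: "V = insert a (V - {a})" using a by auto
  have card: "card (V - {a}) = Suc n" using fin a card_V by simp
  show "card {\<sigma>. \<sigma> permutes V \<and> \<sigma> a = a} = fact (Suc n)"
    unfolding permutes_fixing_iff using card_permutations[OF card] fin by simp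
  have "cycle_excess (insert a (V - {a})) h {\<sigma>. \<sigma> permutes V - {a}} =
      cycle_excess (V - {a}) (h - 1) {\<sigma>. \<sigma> permutes V - {a}}"
    using fin by (intro cycle_excess_insert_fixed) auto
  then show "cycle_excess V h {\<sigma>. \<sigma> permutes V \<and> \<sigma> a = a} = fact (Suc n) * (harm (Suc n) + 1 - h)"
    using V cycle_excess_permutations[of "V - {a}" "h - 1"] fin card
    by (simp add: permutes_fixing_iff diff_diff_eq2)
qed

lemma fixing_two:
  "card {\<sigma>. \<sigma> permutes V \<and> \<sigma> a = a \<and> \<sigma> b = b} = fact n"
  "cycle_excess V h {\<sigma>. \<sigma> permutes V \<and> \<sigma> a = a \<and> \<sigma> b = b} = fact n * (harm n + 2 - h)"
proof -
  let ?W = "V - {a} - {b}"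
  have V: "V = insert a (insert b ?W)" using a b by auto
  have card: "card ?W = n" using fin a b ab card_V by simp
  have eq: "{\<sigma>. \<sigma> permutes V \<and> \<sigma> a = a \<and> \<sigma> b = b} = {\<sigma>. \<sigma> permutes ?W}"
    by (simp flip: permutes_fixing_iff conj_assoc)
  show "card {\<sigma>. \<sigma> permutes V \<and> \<sigma> a = a \<and> \<sigma> b = b} = fact n"
    unfolding eq using card_permutations[OF card] fin by simp
  have "cycle_excess (insert a (insert b ?W)) h {\<sigma>. \<sigma> permutes ?W} =
      cycle_excess (insert b ?W) (h - 1) {\<sigma>. \<sigma> permutes ?W}"
    using fin ab by (intro cycle_excess_insert_fixed) (auto intro: permutes_subset)
  also have "\<dots> = cycle_excess ?W (h - 1 - 1) {\<sigma>. \<sigma> permutes ?W}"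
    using fin by (intro cycle_excess_insert_fixed) auto
  also have "\<dots> = fact n * (harm n + 2 - h)"
    using cycle_excess_permutations[of ?W "h - 1 - 1"] fin card by simp
  finally show "cycle_excess V h {\<sigma>. \<sigma> permutes V \<and> \<sigma> a = a \<and> \<sigma> b = b} = fact n * (harm n + 2 - h)"
    unfolding eq using V by simp
qed

lemma through_arc:
  "card {\<sigma>. \<sigma> permutes V \<and> \<sigma> b = a} = fact (Suc n)"
  "cycle_excess V h {\<sigma>. \<sigma> permutes V \<and> \<sigma> b = a} = fact (Suc n) * (harm (Suc n) - h)"
proof -
  show "card {\<sigma>. \<sigma> permutes V \<and> \<sigma> b = a} = fact (Suc n)"
    unfolding permutes_arc_eq_merge[OF a b] card_comp_transpose by (rule fixing)
  have "cycle_excess V h {\<sigma>. \<sigma> permutes V \<and> \<sigma> b = a} =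
      cycle_excess V h {\<sigma>. \<sigma> permutes V \<and> \<sigma> a = a} - card {\<sigma>. \<sigma> permutes V \<and> \<sigma> a = a}"
    unfolding permutes_arc_eq_merge[OF a b] using fin a b ab
    by (intro cycle_excess_merge) (auto simp: orbit_fixed)
  then show "cycle_excess V h {\<sigma>. \<sigma> permutes V \<and> \<sigma> b = a} = fact (Suc n) * (harm (Suc n) - h)"
    unfolding fixing by (simp add: algebra_simps)
qed

text \<open>
  The transposed values arise from two fixed points by merging them into a two-cycle.
\<close>

lemma through_both_arcs:
  "card {\<sigma>. \<sigma> permutes V \<and> \<sigma> b = a \<and> \<sigma> a = b} = fact n"
  "cycle_excess V h {\<sigma>. \<sigma> permutes V \<and> \<sigma> b = a \<and> \<sigma> a = b} = fact n * (harm n + 1 - h)"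
proof -
  show "card {\<sigma>. \<sigma> permutes V \<and> \<sigma> b = a \<and> \<sigma> a = b} = fact n"
    unfolding permutes_swap_eq_merge[OF a b] card_comp_transpose by (rule fixing_two)
  have "cycle_excess V h {\<sigma>. \<sigma> permutes V \<and> \<sigma> b = a \<and> \<sigma> a = b} =
      cycle_excess V h {\<sigma>. \<sigma> permutes V \<and> \<sigma> a = a \<and> \<sigma> b = b} -
      card {\<sigma>. \<sigma> permutes V \<and> \<sigma> a = a \<and> \<sigma> b = b}"
    unfolding permutes_swap_eq_merge[OF a b] using fin a b ab
    by (intro cycle_excess_merge) (auto simp: orbit_fixed)
  then show "cycle_excess V h {\<sigma>. \<sigma> permutes V \<and> \<sigma> b = a \<and> \<sigma> a = b} = fact n * (harm n + 1 - h)"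
    unfolding fixing_two by (simp add: algebra_simps)
qed

lemma through_one_arc:
  "real (card {\<sigma>. \<sigma> permutes V \<and> \<sigma> b = a \<and> \<sigma> a \<noteq> b}) = fact n * n"
  "cycle_excess V h {\<sigma>. \<sigma> permutes V \<and> \<sigma> b = a \<and> \<sigma> a \<noteq> b} =
    fact (Suc n) * (harm (Suc n) - h) - fact n * (harm n + 1 - h)"
proof -
  let ?P = "{\<sigma>. \<sigma> permutes V \<and> \<sigma> b = a}"
  let ?P1 = "{\<sigma>. \<sigma> permutes V \<and> \<sigma> b = a \<and> \<sigma> a \<noteq> b}"
  let ?P2 = "{\<sigma>. \<sigma> permutes V \<and> \<sigma> b = a \<and> \<sigma> a = b}"
  have P: "?P = ?P1 \<union> ?P2" "?P1 \<inter> ?P2 = {}" by auto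
  have "card ?P = card ?P1 + card ?P2"
    unfolding P(1) using P(2) by (intro card_Un_disjoint finite_perms)
  then have "real (fact (Suc n)) = real (card ?P1) + real (fact n)"
    unfolding through_arc through_both_arcs by linarith
  then show "real (card ?P1) = fact n * n"
    by (simp add: algebra_simps)
  have "cycle_excess V h ?P = cycle_excess V h ?P1 + cycle_excess V h ?P2"
    unfolding P(1) using P(2) by (intro cycle_excess_union_disjoint finite_perms)
  then show "cycle_excess V h ?P1 = fact (Suc n) * (harm (Suc n) - h) - fact n * (harm n + 1 - h)"
    unfolding through_arc through_both_arcs by simp
qed

end

text \<open>
  The complement consists of the permutations through the arc from \<open>b\<close> to \<open>a\<close>
  and of those through the opposite arc only.
\<close>

lemma avoiding_both_arcs:
  fixes V :: "'a set"
  assumes fin: "finite V" and card_V: "card V = Suc (Suc n)"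
    and a: "a \<in> V" and b: "b \<in> V" and ab: "a \<noteq> b"
  defines "P \<equiv> {\<sigma>. \<sigma> permutes V \<and> \<sigma> a \<noteq> b \<and> \<sigma> b \<noteq> a}"
  shows "real (card P) = fact n * (real n * (real n + 1) + 1)"
    and "cycle_excess V h P = fact (Suc (Suc n)) * (harm (Suc (Suc n)) - h)
      - 2 * (fact (Suc n) * (harm (Suc n) - h)) + fact n * (harm n + 1 - h)"
proof -
  let ?P = "{\<sigma>. \<sigma> permutes V}"
  let ?P1 = "{\<sigma>. \<sigma> permutes V \<and> \<sigma> b = a}"
  let ?P2 = "{\<sigma>. \<sigma> permutes V \<and> \<sigma> a = b \<and> \<sigma> b \<noteq> a}"
  note arc = through_arc[OF fin card_V a b ab]
  note one = through_one_arc[OF fin card_V b a ab[symmetric]]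
  have fins: "finite P" "finite ?P1" "finite ?P2" "finite (?P1 \<union> ?P2)"
    unfolding P_def using finite_permutations[OF fin] by simp_all
  have P: "?P = P \<union> (?P1 \<union> ?P2)" "P \<inter> (?P1 \<union> ?P2) = {}" "?P1 \<inter> ?P2 = {}"
    unfolding P_def by auto
  have "card ?P = card P + (card ?P1 + card ?P2)"
    unfolding P(1) using P(2,3) fins by (simp add: card_Un_disjoint)
  then have "real (fact (Suc (Suc n))) = real (card P) + (real (fact (Suc n)) + fact n * n)"
    unfolding card_permutations[OF card_V fin] arc one(1)[symmetric] by linarith
  then show "real (card P) = fact n * (real n * (real n + 1) + 1)"
    by (simp add: algebra_simps)
  have "cycle_excess V h ?P = cycle_excess V h P + (cycle_excess V h ?P1 + cycle_excess V h ?P2)"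
    unfolding P(1) using P(2,3) fins by (simp add: cycle_excess_union_disjoint)
  then show "cycle_excess V h P = fact (Suc (Suc n)) * (harm (Suc (Suc n)) - h)
      - 2 * (fact (Suc n) * (harm (Suc n) - h)) + fact n * (harm n + 1 - h)"
    unfolding arc one cycle_excess_permutations[OF fin] card_V by linarith
qed

section \<open>Switching an edge between two complete blocks\<close>

lemma orbit_subset_invariant:
  assumes "\<And>y. y \<in> S \<Longrightarrow> f y \<in> S" "x \<in> S"
  shows "orbit f x \<subseteq> S"
proof
  fix y assume "y \<in> orbit f x"
  then show "y \<in> S" by induction (use assms in auto)
qed

text \<open>
  Exactly \<open>card B\<close> arcs of \<open>\<sigma>\<close> start in \<open>B\<close> and equally many end there; the arcs inside \<open>B\<close> belong to
  both kinds.
\<close>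

lemma card_crossings_eq:
  assumes "\<sigma> permutes B \<union> C" "B \<inter> C = {}" "finite B" "finite C"
  shows "card {x \<in> B. \<sigma> x \<in> C} = card {x \<in> C. \<sigma> x \<in> B}"
proof -
  let ?BB = "{x \<in> B. \<sigma> x \<in> B}" and ?BC = "{x \<in> B. \<sigma> x \<in> C}" and ?CB = "{x \<in> C. \<sigma> x \<in> B}"
  have inj: "inj \<sigma>" by (rule permutes_inj[OF assms(1)])
  have "B = ?BB \<union> ?BC"
    using permutes_in_image[OF assms(1)] by auto
  then have "card B = card (?BB \<union> ?BC)" by simp
  also have "\<dots> = card ?BB + card ?BC"
    using assms by (intro card_Un_disjoint) auto
  finally have 1: "card B = card ?BB + card ?BC" .
  have "B \<subseteq> \<sigma> ` (B \<union> C)"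
    unfolding permutes_image[OF assms(1)] by blast
  then have "\<sigma> ` (?BB \<union> ?CB) = B" by blast
  then have "card B = card (?BB \<union> ?CB)"
    using card_image[OF inj_on_subset[OF inj subset_UNIV], of "?BB \<union> ?CB"] by simp
  also have "\<dots> = card ?BB + card ?CB"
    using assms by (intro card_Un_disjoint) auto
  finally show ?thesis using 1 by simp
qed

text \<open>
  The size of the blocks is written as \<open>n + 2\<close> because the counts involve permutations of the
  block with one or two points removed.
\<close>

locale two_blocks =
  fixes B C :: "'a set" and a b a' b' :: 'a and n :: nat
  assumes finB: "finite B" and finC: "finite C" and disj: "B \<inter> C = {}"
    and cardB: "card B = Suc (Suc n)" and cardC: "card C = Suc (Suc n)"
    and a: "a \<in> B" and b: "b \<in> B" and ab: "a \<noteq> b"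
    and a': "a' \<in> C" and b': "b' \<in> C" and ab': "a' \<noteq> b'"
begin

definition switched :: "'a pair_pre_digraph" where
  "switched = \<lparr>pverts = B \<union> C,
     parcs = (B \<times> B \<union> C \<times> C - {(a, b), (b, a), (a', b'), (b', a')})
       \<union> {(a, a'), (a', a), (b, b'), (b', b)}\<rparr>"

text \<open>
  The four flags say which of the crossing arcs \<open>(a, a')\<close>, \<open>(b, b')\<close>, \<open>(a', a)\<close>, \<open>(b', b)\<close> are
  used, in this order.
\<close>

definition factors_with :: "bool \<Rightarrow> bool \<Rightarrow> bool \<Rightarrow> bool \<Rightarrow> ('a \<Rightarrow> 'a) set" where
  "factors_with p q r s = {\<sigma> \<in> cycle_factors switched.
     (\<sigma> a = a') = p \<and> (\<sigma> b = b') = q \<and> (\<sigma> a' = a) = r \<and> (\<sigma> b' = b) = s}"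

lemma marked_distinct:
  "a \<notin> C" "b \<notin> C" "a' \<notin> B" "b' \<notin> B" "a \<noteq> a'" "a \<noteq> b'" "b \<noteq> a'" "b \<noteq> b'"
  "a' \<noteq> a" "b' \<noteq> a" "a' \<noteq> b" "b' \<noteq> b" "b \<noteq> a" "b' \<noteq> a'"
  using a b a' b' disj ab ab' by auto

lemmas marked = a b a' b' ab ab' marked_distinct

lemma ball_B: "(\<forall>x\<in>B. \<phi> x) \<longleftrightarrow> \<phi> a \<and> \<phi> b \<and> (\<forall>x\<in>B - {a, b}. \<phi> x)"
  and ball_C: "(\<forall>x\<in>C. \<phi> x) \<longleftrightarrow> \<phi> a' \<and> \<phi> b' \<and> (\<forall>x\<in>C - {a', b'}. \<phi> x)"
  using a b a' b' by auto

lemma mem_cycle_factors_switched: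
  "\<sigma> \<in> cycle_factors switched \<longleftrightarrow> \<sigma> permutes B \<union> C \<and>
    (\<sigma> a = a' \<or> \<sigma> a \<in> B \<and> \<sigma> a \<noteq> b) \<and> (\<sigma> b = b' \<or> \<sigma> b \<in> B \<and> \<sigma> b \<noteq> a) \<and>
    (\<sigma> a' = a \<or> \<sigma> a' \<in> C \<and> \<sigma> a' \<noteq> b') \<and> (\<sigma> b' = b \<or> \<sigma> b' \<in> C \<and> \<sigma> b' \<noteq> a') \<and>
    (\<forall>x\<in>B - {a, b}. \<sigma> x \<in> B) \<and> (\<forall>x\<in>C - {a', b'}. \<sigma> x \<in> C)"
proof -
  have "(x, y) \<in> parcs switched \<longleftrightarrow> y \<in> B" if "x \<in> B - {a, b}" for x y
    using that disj marked by (auto simp: switched_def)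
  moreover have "(x, y) \<in> parcs switched \<longleftrightarrow> y \<in> C" if "x \<in> C - {a', b'}" for x y
    using that disj marked by (auto simp: switched_def)
  moreover have "(a, y) \<in> parcs switched \<longleftrightarrow> y = a' \<or> y \<in> B \<and> y \<noteq> b" for y
    using marked by (auto simp: switched_def)
  moreover have "(b, y) \<in> parcs switched \<longleftrightarrow> y = b' \<or> y \<in> B \<and> y \<noteq> a" for y
    using marked by (auto simp: switched_def)
  moreover have "(a', y) \<in> parcs switched \<longleftrightarrow> y = a \<or> y \<in> C \<and> y \<noteq> b'" for y
    using marked by (auto simp: switched_def)
  moreover have "(b', y) \<in> parcs switched \<longleftrightarrow> y = b \<or> y \<in> C \<and> y \<noteq> a'" for y
    using marked by (auto simp: switched_def)
  moreover have "pverts switched = B \<union> C" by (simp add: switched_def)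
  ultimately show ?thesis
    unfolding cycle_factors_def by (simp add: ball_Un ball_B ball_C conj_commute conj_left_commute)
qed

lemma transpose_unmarked:
  assumes "x \<in> {a, b, a', b'}" "y \<in> {a, b, a', b'}"
  shows "z \<in> B - {a, b} \<Longrightarrow> Transposition.transpose x y z = z"
    and "z \<in> C - {a', b'} \<Longrightarrow> Transposition.transpose x y z = z"
  using assms disj marked by (auto simp: Transposition.transpose_def)

lemma permutes_comp_transpose_marked:
  assumes "x \<in> {a, b, a', b'}" "y \<in> {a, b, a', b'}"
  shows "\<sigma> \<circ> Transposition.transpose x y permutes B \<union> C \<longleftrightarrow> \<sigma> permutes B \<union> C"
  by (rule permutes_comp_transpose_iff) (use assms marked in auto)

lemmas factors_simps =
  mem_comp_transpose_iff mem_block_products_iff[OF disj] perm_restrict_simps marked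
  permutes_comp_transpose_marked ball_B ball_C transpose_unmarked
  factors_with_def mem_cycle_factors_switched

text \<open>
  In each of the following descriptions the transpositions redirect the crossing arcs back into the blocks.
  If only \<open>aa'\<close> is used, in both directions, redirecting turns \<open>a\<close> and \<open>a'\<close> into fixed points, so
  the deleted edges are avoided automatically. If a factor leaves \<open>B\<close> at \<open>a\<close> and comes back at \<open>b\<close>,
  redirecting yields the deleted arcs from \<open>a\<close> to \<open>b\<close> and from \<open>b'\<close> to \<open>a'\<close>, and the opposite
  deleted arcs have to be avoided.
\<close>

lemma factors_with_none:
  "factors_with False False False False = block_products
      {\<sigma>. \<sigma> permutes B \<and> \<sigma> a \<noteq> b \<and> \<sigma> b \<noteq> a}
      {\<tau>. \<tau> permutes C \<and> \<tau> a' \<noteq> b' \<and> \<tau> b' \<noteq> a'}"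
proof (rule set_eqI)
  fix \<sigma>
  show "\<sigma> \<in> factors_with False False False False \<longleftrightarrow> \<sigma> \<in> block_products
      {\<sigma>. \<sigma> permutes B \<and> \<sigma> a \<noteq> b \<and> \<sigma> b \<noteq> a}
      {\<tau>. \<tau> permutes C \<and> \<tau> a' \<noteq> b' \<and> \<tau> b' \<noteq> a'}"
  proof (cases "\<sigma> permutes B \<union> C")
    case True
    then have "\<sigma> x = \<sigma> y \<longleftrightarrow> x = y" for x y
      by (rule inj_eq[OF permutes_inj])
    then have "\<sigma> a \<noteq> \<sigma> a'" "\<sigma> a \<noteq> \<sigma> b'" "\<sigma> b \<noteq> \<sigma> a'" "\<sigma> b \<noteq> \<sigma> b'"
      "\<sigma> a \<noteq> \<sigma> b" "\<sigma> a' \<noteq> \<sigma> b'"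
      using marked by simp_all
    with True show ?thesis
      by (simp add: factors_simps) (smt (verit) marked)
  qed (simp add: factors_simps)
qed

lemma factors_with_edge_a:
  "factors_with True False True False = (\<lambda>\<rho>. \<rho> \<circ> Transposition.transpose a a') ` block_products
      {\<sigma>. \<sigma> permutes B \<and> \<sigma> a = a}
      {\<tau>. \<tau> permutes C \<and> \<tau> a' = a'}"
proof (rule set_eqI)
  fix \<sigma>
  show "\<sigma> \<in> factors_with True False True False \<longleftrightarrow> \<sigma> \<in> (\<lambda>\<rho>. \<rho> \<circ> Transposition.transpose a a') ` block_products
      {\<sigma>. \<sigma> permutes B \<and> \<sigma> a = a}
      {\<tau>. \<tau> permutes C \<and> \<tau> a' = a'}"
  proof (cases "\<sigma> permutes B \<union> C")
    case True
    then have "\<sigma> x = \<sigma> y \<longleftrightarrow> x = y" for x y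
      by (rule inj_eq[OF permutes_inj])
    \<comment> \<open>Injectivity excludes the deleted arc from \<open>b\<close> to \<open>a\<close>, since \<open>\<sigma>\<close> maps \<open>a'\<close> to \<open>a\<close>;
      likewise for its counterpart in \<open>C\<close>.\<close>
    then have "\<sigma> a \<noteq> \<sigma> a'" "\<sigma> a \<noteq> \<sigma> b'" "\<sigma> b \<noteq> \<sigma> a'" "\<sigma> b \<noteq> \<sigma> b'"
      "\<sigma> a \<noteq> \<sigma> b" "\<sigma> a' \<noteq> \<sigma> b'"
      using marked by simp_all
    with True show ?thesis
      by (simp add: factors_simps) (smt (verit) marked)
  qed (simp add: factors_simps)
qed

lemma factors_with_edge_b:
  "factors_with False True False True = (\<lambda>\<rho>. \<rho> \<circ> Transposition.transpose b b') ` block_products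
      {\<sigma>. \<sigma> permutes B \<and> \<sigma> b = b}
      {\<tau>. \<tau> permutes C \<and> \<tau> b' = b'}"
proof (rule set_eqI)
  fix \<sigma>
  show "\<sigma> \<in> factors_with False True False True \<longleftrightarrow> \<sigma> \<in> (\<lambda>\<rho>. \<rho> \<circ> Transposition.transpose b b') ` block_products
      {\<sigma>. \<sigma> permutes B \<and> \<sigma> b = b}
      {\<tau>. \<tau> permutes C \<and> \<tau> b' = b'}"
  proof (cases "\<sigma> permutes B \<union> C")
    case True
    then have "\<sigma> x = \<sigma> y \<longleftrightarrow> x = y" for x y
      by (rule inj_eq[OF permutes_inj])
    then have "\<sigma> a \<noteq> \<sigma> a'" "\<sigma> a \<noteq> \<sigma> b'" "\<sigma> b \<noteq> \<sigma> a'" "\<sigma> b \<noteq> \<sigma> b'"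
      "\<sigma> a \<noteq> \<sigma> b" "\<sigma> a' \<noteq> \<sigma> b'"
      using marked by simp_all
    with True show ?thesis
      by (simp add: factors_simps) (smt (verit) marked)
  qed (simp add: factors_simps)
qed

lemma factors_with_both_edges:
  "factors_with True True True True = (\<lambda>\<rho>. \<rho> \<circ> Transposition.transpose b b') ` ((\<lambda>\<rho>. \<rho> \<circ> Transposition.transpose a a') ` block_products
      {\<sigma>. \<sigma> permutes B \<and> \<sigma> a = a \<and> \<sigma> b = b}
      {\<tau>. \<tau> permutes C \<and> \<tau> a' = a' \<and> \<tau> b' = b'})"
proof (rule set_eqI)
  fix \<sigma>
  show "\<sigma> \<in> factors_with True True True True \<longleftrightarrow> \<sigma> \<in> (\<lambda>\<rho>. \<rho> \<circ> Transposition.transpose b b') ` ((\<lambda>\<rho>. \<rho> \<circ> Transposition.transpose a a') ` block_products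
      {\<sigma>. \<sigma> permutes B \<and> \<sigma> a = a \<and> \<sigma> b = b}
      {\<tau>. \<tau> permutes C \<and> \<tau> a' = a' \<and> \<tau> b' = b'})"
  proof (cases "\<sigma> permutes B \<union> C")
    case True
    then have "\<sigma> x = \<sigma> y \<longleftrightarrow> x = y" for x y
      by (rule inj_eq[OF permutes_inj])
    then have "\<sigma> a \<noteq> \<sigma> a'" "\<sigma> a \<noteq> \<sigma> b'" "\<sigma> b \<noteq> \<sigma> a'" "\<sigma> b \<noteq> \<sigma> b'"
      "\<sigma> a \<noteq> \<sigma> b" "\<sigma> a' \<noteq> \<sigma> b'"
      using marked by simp_all
    with True show ?thesis
      by (simp add: factors_simps) (smt (verit) marked)
  qed (simp add: factors_simps)
qed

lemma factors_with_detour_a: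
  "factors_with True False False True = (\<lambda>\<rho>. \<rho> \<circ> Transposition.transpose a b') ` block_products
      {\<sigma>. \<sigma> permutes B \<and> \<sigma> a = b \<and> \<sigma> b \<noteq> a}
      {\<tau>. \<tau> permutes C \<and> \<tau> b' = a' \<and> \<tau> a' \<noteq> b'}"
proof (rule set_eqI)
  fix \<sigma>
  show "\<sigma> \<in> factors_with True False False True \<longleftrightarrow> \<sigma> \<in> (\<lambda>\<rho>. \<rho> \<circ> Transposition.transpose a b') ` block_products
      {\<sigma>. \<sigma> permutes B \<and> \<sigma> a = b \<and> \<sigma> b \<noteq> a}
      {\<tau>. \<tau> permutes C \<and> \<tau> b' = a' \<and> \<tau> a' \<noteq> b'}"
  proof (cases "\<sigma> permutes B \<union> C")
    case True
    then have "\<sigma> x = \<sigma> y \<longleftrightarrow> x = y" for x y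
      by (rule inj_eq[OF permutes_inj])
    then have "\<sigma> a \<noteq> \<sigma> a'" "\<sigma> a \<noteq> \<sigma> b'" "\<sigma> b \<noteq> \<sigma> a'" "\<sigma> b \<noteq> \<sigma> b'"
      "\<sigma> a \<noteq> \<sigma> b" "\<sigma> a' \<noteq> \<sigma> b'"
      using marked by simp_all
    with True show ?thesis
      by (simp add: factors_simps) (smt (verit) marked)
  qed (simp add: factors_simps)
qed

lemma factors_with_detour_b:
  "factors_with False True True False = (\<lambda>\<rho>. \<rho> \<circ> Transposition.transpose b a') ` block_products
      {\<sigma>. \<sigma> permutes B \<and> \<sigma> b = a \<and> \<sigma> a \<noteq> b}
      {\<tau>. \<tau> permutes C \<and> \<tau> a' = b' \<and> \<tau> b' \<noteq> a'}"
proof (rule set_eqI)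
  fix \<sigma>
  show "\<sigma> \<in> factors_with False True True False \<longleftrightarrow> \<sigma> \<in> (\<lambda>\<rho>. \<rho> \<circ> Transposition.transpose b a') ` block_products
      {\<sigma>. \<sigma> permutes B \<and> \<sigma> b = a \<and> \<sigma> a \<noteq> b}
      {\<tau>. \<tau> permutes C \<and> \<tau> a' = b' \<and> \<tau> b' \<noteq> a'}"
  proof (cases "\<sigma> permutes B \<union> C")
    case True
    then have "\<sigma> x = \<sigma> y \<longleftrightarrow> x = y" for x y
      by (rule inj_eq[OF permutes_inj])
    then have "\<sigma> a \<noteq> \<sigma> a'" "\<sigma> a \<noteq> \<sigma> b'" "\<sigma> b \<noteq> \<sigma> a'" "\<sigma> b \<noteq> \<sigma> b'"
      "\<sigma> a \<noteq> \<sigma> b" "\<sigma> a' \<noteq> \<sigma> b'"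
      using marked by simp_all
    with True show ?thesis
      by (simp add: factors_simps) (smt (verit) marked)
  qed (simp add: factors_simps)
qed


lemma finite_factors: "finite (cycle_factors switched)" "finite (factors_with p q r s)"
proof -
  have "cycle_factors switched \<subseteq> {\<sigma>. \<sigma> permutes B \<union> C}"
    by (auto simp: mem_cycle_factors_switched)
  then show "finite (cycle_factors switched)"
    by (rule finite_subset) (intro finite_permutations finite_UnI finB finC)
  then show "finite (factors_with p q r s)"
    by (simp add: factors_with_def)
qed

lemma cycle_factors_switched_eq:
  "cycle_factors switched =
    factors_with False False False False \<union> (factors_with True False True False \<union>
    (factors_with False True False True \<union> (factors_with True True True True \<union>
    (factors_with True False False True \<union> factors_with False True True False))))"
    (is "_ = ?R")
proof
  show "?R \<subseteq> cycle_factors switched" by (auto simp: factors_with_def)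
  show "cycle_factors switched \<subseteq> ?R"
  proof
    fix \<sigma> assume cf: "\<sigma> \<in> cycle_factors switched"
    then have perm: "\<sigma> permutes B \<union> C" by (simp add: mem_cycle_factors_switched)
    have cases: "\<sigma> a = a' \<or> \<sigma> a \<in> B" "\<sigma> b = b' \<or> \<sigma> b \<in> B"
      "\<sigma> a' = a \<or> \<sigma> a' \<in> C" "\<sigma> b' = b \<or> \<sigma> b' \<in> C"
      "\<And>x. x \<in> B - {a, b} \<Longrightarrow> \<sigma> x \<in> B" "\<And>x. x \<in> C - {a', b'} \<Longrightarrow> \<sigma> x \<in> C"
      using cf by (simp_all add: mem_cycle_factors_switched) (elim conjE disjE; simp)+
    have card_pair: "card {z \<in> {x, y}. \<sigma> z \<in> S} = of_bool (\<sigma> x \<in> S) + of_bool (\<sigma> y \<in> S)"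
      if "x \<noteq> y" for x y S
    proof -
      have "{z \<in> {x, y}. \<sigma> z \<in> S} = (if \<sigma> x \<in> S then {x} else {}) \<union> (if \<sigma> y \<in> S then {y} else {})"
        by auto
      then show ?thesis using that by simp
    qed
    have disjD: "x \<in> B \<Longrightarrow> x \<notin> C" for x using disj by blast
    have B: "\<sigma> a \<in> C \<longleftrightarrow> \<sigma> a = a'" "\<sigma> b \<in> C \<longleftrightarrow> \<sigma> b = b'"
      "\<And>x. x \<in> B - {a, b} \<Longrightarrow> \<sigma> x \<notin> C"
      using cases(1,2,5) disjD a' b' by metis+
    have C: "\<sigma> a' \<in> B \<longleftrightarrow> \<sigma> a' = a" "\<sigma> b' \<in> B \<longleftrightarrow> \<sigma> b' = b"
      "\<And>x. x \<in> C - {a', b'} \<Longrightarrow> \<sigma> x \<notin> B"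
      using cases(3,4,6) disjD a b by metis+
    have "{x \<in> B. \<sigma> x \<in> C} = {x \<in> {a, b}. \<sigma> x \<in> C}"
      using a b B(3) by blast
    also have "card \<dots> = of_bool (\<sigma> a \<in> C) + of_bool (\<sigma> b \<in> C)"
      by (rule card_pair[OF ab])
    finally have "card {x \<in> B. \<sigma> x \<in> C} = of_bool (\<sigma> a = a') + of_bool (\<sigma> b = b')"
      unfolding B .
    moreover have "{x \<in> C. \<sigma> x \<in> B} = {x \<in> {a', b'}. \<sigma> x \<in> B}"
      using a' b' C(3) by blast
    moreover have "card \<dots> = of_bool (\<sigma> a' \<in> B) + of_bool (\<sigma> b' \<in> B)"
      by (rule card_pair[OF ab'])
    ultimately have "of_bool (\<sigma> a = a') + of_bool (\<sigma> b = b') =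
        (of_bool (\<sigma> a' = a) + of_bool (\<sigma> b' = b) :: nat)"
      using card_crossings_eq[OF perm disj finB finC] unfolding C by simp
    then show "\<sigma> \<in> ?R"
      unfolding factors_with_def Un_iff mem_Collect_eq using cf
      by (cases "\<sigma> a = a'"; cases "\<sigma> b = b'"; cases "\<sigma> a' = a"; cases "\<sigma> b' = b") simp_all
  qed
qed

lemma cycle_excess_switched_eq:
  "cycle_excess (B \<union> C) h (cycle_factors switched) =
    cycle_excess (B \<union> C) h (factors_with False False False False) +
    (cycle_excess (B \<union> C) h (factors_with True False True False) +
    (cycle_excess (B \<union> C) h (factors_with False True False True) +
    (cycle_excess (B \<union> C) h (factors_with True True True True) +
    (cycle_excess (B \<union> C) h (factors_with True False False True) +
     cycle_excess (B \<union> C) h (factors_with False True True False)))))"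
proof -
  have "factors_with p q r s \<inter> factors_with p' q' r' s' = {}"
    if "(p, q, r, s) \<noteq> (p', q', r', s')" for p q r s p' q' r' s'
    using that by (auto simp: factors_with_def)
  then show ?thesis
    unfolding cycle_factors_switched_eq
    by (simp add: cycle_excess_union_disjoint finite_factors Int_Un_distrib)
qed

lemma cycle_excess_products:
  assumes "P \<subseteq> {\<sigma>. \<sigma> permutes B}" "Q \<subseteq> {\<tau>. \<tau> permutes C}"
  shows "cycle_excess (B \<union> C) (h + h) (block_products P Q) =
    real (card Q) * cycle_excess B h P + real (card P) * cycle_excess C h Q"
  using assms by (intro cycle_excess_block_products disj finB finC) auto

text \<open>
  The two transposed points lie in different blocks, hence in different cycles of any product.
\<close>

lemma cycle_excess_merged_products:
  assumes "P \<subseteq> {\<sigma>. \<sigma> permutes B}" "Q \<subseteq> {\<tau>. \<tau> permutes C}" "x \<in> B" "y \<in> C"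
  shows "cycle_excess (B \<union> C) (h + h)
      ((\<lambda>\<rho>. \<rho> \<circ> Transposition.transpose x y) ` block_products P Q) =
    real (card Q) * cycle_excess B h P + real (card P) * cycle_excess C h Q
      - real (card P) * real (card Q)"
proof -
  have "\<rho> permutes B \<union> C \<and> y \<notin> orbit \<rho> x" if \<rho>: "\<rho> \<in> block_products P Q" for \<rho>
  proof -
    have "block_products P Q \<subseteq>
        block_products {\<sigma>. \<sigma> permutes B \<and> True} {\<tau>. \<tau> permutes C \<and> True}"
      unfolding block_products_def using assms(1,2) by (intro image_mono Sigma_mono) auto
    with \<rho> have "\<rho> \<in> block_products {\<sigma>. \<sigma> permutes B \<and> True} {\<tau>. \<tau> permutes C \<and> True}"
      by blast
    then have "\<rho> permutes B \<union> C" "\<And>z. z \<in> B \<Longrightarrow> \<rho> z \<in> B"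
      unfolding mem_block_products_iff[OF disj] by blast+
    then show ?thesis
      using orbit_subset_invariant[of B \<rho> x] assms(3,4) disj by (simp add: disjoint_iff subset_iff) metis
  qed
  then have "cycle_excess (B \<union> C) (h + h)
      ((\<lambda>\<rho>. \<rho> \<circ> Transposition.transpose x y) ` block_products P Q) =
      cycle_excess (B \<union> C) (h + h) (block_products P Q) - real (card (block_products P Q))"
    using assms(3,4) finB finC by (intro cycle_excess_merge) auto
  also have "card (block_products P Q) = card P * card Q"
    using assms(1,2) by (intro card_block_products[OF disj]) auto
  also note cycle_excess_products[OF assms(1,2)]
  finally show ?thesis by (simp only: of_nat_mult)
qed

lemmas blockB = finB cardB and blockC = finC cardC

lemma cycle_excess_none:
  fixes h :: real
  defines "t \<equiv> fact (Suc (Suc n)) * (harm (Suc (Suc n)) - h)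
      - 2 * (fact (Suc n) * (harm (Suc n) - h)) + fact n * (harm n + 1 - h)"
  shows "cycle_excess (B \<union> C) (h + h) (factors_with False False False False) =
    2 * (fact n * (real n * (real n + 1) + 1)) * t"
  unfolding factors_with_none t_def
  by (subst cycle_excess_products)
    (auto simp only: avoiding_both_arcs[OF blockB a b ab] avoiding_both_arcs[OF blockC a' b' ab'])

lemma cycle_excess_edge_a:
  "cycle_excess (B \<union> C) (h + h) (factors_with True False True False) =
    2 * fact (Suc n) * (fact (Suc n) * (harm (Suc n) + 1 - h)) - fact (Suc n) * fact (Suc n)"
proof -
  have "cycle_excess (B \<union> C) (h + h) (factors_with True False True False) =
      real (card {\<tau>. \<tau> permutes C \<and> \<tau> a' = a'}) * cycle_excess B h {\<sigma>. \<sigma> permutes B \<and> \<sigma> a = a} + real (card {\<sigma>. \<sigma> permutes B \<and> \<sigma> a = a}) * cycle_excess C h {\<tau>. \<tau> permutes C \<and> \<tau> a' = a'}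
      - real (card {\<sigma>. \<sigma> permutes B \<and> \<sigma> a = a}) * real (card {\<tau>. \<tau> permutes C \<and> \<tau> a' = a'})"
    unfolding factors_with_edge_a by (rule cycle_excess_merged_products) (use marked in auto)
  then show ?thesis
    unfolding fixing[OF blockB a b ab]
      fixing[OF blockC a' b' ab'] by (simp add: algebra_simps)
qed

lemma cycle_excess_edge_b:
  "cycle_excess (B \<union> C) (h + h) (factors_with False True False True) =
    2 * fact (Suc n) * (fact (Suc n) * (harm (Suc n) + 1 - h)) - fact (Suc n) * fact (Suc n)"
proof -
  have "cycle_excess (B \<union> C) (h + h) (factors_with False True False True) =
      real (card {\<tau>. \<tau> permutes C \<and> \<tau> b' = b'}) * cycle_excess B h {\<sigma>. \<sigma> permutes B \<and> \<sigma> b = b} + real (card {\<sigma>. \<sigma> permutes B \<and> \<sigma> b = b}) * cycle_excess C h {\<tau>. \<tau> permutes C \<and> \<tau> b' = b'}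
      - real (card {\<sigma>. \<sigma> permutes B \<and> \<sigma> b = b}) * real (card {\<tau>. \<tau> permutes C \<and> \<tau> b' = b'})"
    unfolding factors_with_edge_b by (rule cycle_excess_merged_products) (use marked in auto)
  then show ?thesis
    unfolding fixing[OF blockB b a ab[symmetric]]
      fixing[OF blockC b' a' ab'[symmetric]] by (simp add: algebra_simps)
qed

lemma cycle_excess_detour_a:
  "cycle_excess (B \<union> C) (h + h) (factors_with True False False True) =
    2 * (fact n * real n) * (fact (Suc n) * (harm (Suc n) - h) - fact n * (harm n + 1 - h))
      - (fact n * real n) * (fact n * real n)"
proof -
  have "cycle_excess (B \<union> C) (h + h) (factors_with True False False True) =
      real (card {\<tau>. \<tau> permutes C \<and> \<tau> b' = a' \<and> \<tau> a' \<noteq> b'}) * cycle_excess B h {\<sigma>. \<sigma> permutes B \<and> \<sigma> a = b \<and> \<sigma> b \<noteq> a} + real (card {\<sigma>. \<sigma> permutes B \<and> \<sigma> a = b \<and> \<sigma> b \<noteq> a}) * cycle_excess C h {\<tau>. \<tau> permutes C \<and> \<tau> b' = a' \<and> \<tau> a' \<noteq> b'}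
      - real (card {\<sigma>. \<sigma> permutes B \<and> \<sigma> a = b \<and> \<sigma> b \<noteq> a}) * real (card {\<tau>. \<tau> permutes C \<and> \<tau> b' = a' \<and> \<tau> a' \<noteq> b'})"
    unfolding factors_with_detour_a by (rule cycle_excess_merged_products) (use marked in auto)
  then show ?thesis
    unfolding through_one_arc[OF blockB b a ab[symmetric]]
      through_one_arc[OF blockC a' b' ab'] by simp
qed

lemma cycle_excess_detour_b:
  "cycle_excess (B \<union> C) (h + h) (factors_with False True True False) =
    2 * (fact n * real n) * (fact (Suc n) * (harm (Suc n) - h) - fact n * (harm n + 1 - h))
      - (fact n * real n) * (fact n * real n)"
proof -
  have "cycle_excess (B \<union> C) (h + h) (factors_with False True True False) =
      real (card {\<tau>. \<tau> permutes C \<and> \<tau> a' = b' \<and> \<tau> b' \<noteq> a'}) * cycle_excess B h {\<sigma>. \<sigma> permutes B \<and> \<sigma> b = a \<and> \<sigma> a \<noteq> b} + real (card {\<sigma>. \<sigma> permutes B \<and> \<sigma> b = a \<and> \<sigma> a \<noteq> b}) * cycle_excess C h {\<tau>. \<tau> permutes C \<and> \<tau> a' = b' \<and> \<tau> b' \<noteq> a'}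
      - real (card {\<sigma>. \<sigma> permutes B \<and> \<sigma> b = a \<and> \<sigma> a \<noteq> b}) * real (card {\<tau>. \<tau> permutes C \<and> \<tau> a' = b' \<and> \<tau> b' \<noteq> a'})"
    unfolding factors_with_detour_b by (rule cycle_excess_merged_products) (use marked in auto)
  then show ?thesis
    unfolding through_one_arc[OF blockB a b ab]
      through_one_arc[OF blockC b' a' ab'[symmetric]] by simp
qed

text \<open>
  The second merge still joins two cycles, because \<open>b\<close> remains a fixed point after the first.
\<close>

lemma cycle_excess_both_edges:
  fixes h :: real
  shows "cycle_excess (B \<union> C) (h + h) (factors_with True True True True) =
    2 * fact n * (fact n * (harm n + 2 - h)) - 2 * (fact n * fact n)"
proof -
  let ?P = "{\<sigma>. \<sigma> permutes B \<and> \<sigma> a = a \<and> \<sigma> b = b}"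
  let ?Q = "{\<tau>. \<tau> permutes C \<and> \<tau> a' = a' \<and> \<tau> b' = b'}"
  let ?K = "(\<lambda>\<rho>. \<rho> \<circ> Transposition.transpose a a') ` block_products ?P ?Q"
  have "\<rho> permutes B \<union> C \<and> b' \<notin> orbit \<rho> b" if "\<rho> \<in> ?K" for \<rho>
  proof -
    from that have *: "\<rho> \<circ> Transposition.transpose a a' \<in> block_products ?P ?Q"
      by (simp only: mem_comp_transpose_iff)
    then have "\<rho> permutes B \<union> C"
      unfolding mem_block_products_iff[OF disj] by (simp add: permutes_comp_transpose_marked)
    moreover from * have "\<rho> b = b"
      unfolding mem_block_products_iff[OF disj] by (simp add: perm_restrict_simps marked)
    ultimately show ?thesis by (simp add: orbit_fixed marked)
  qed
  then have "cycle_excess (B \<union> C) (h + h) (factors_with True True True True) =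
      cycle_excess (B \<union> C) (h + h) ?K - real (card ?K)"
    unfolding factors_with_both_edges using finB finC b b' by (intro cycle_excess_merge) auto
  also have "cycle_excess (B \<union> C) (h + h) ?K =
      real (card ?Q) * cycle_excess B h ?P + real (card ?P) * cycle_excess C h ?Q
      - real (card ?P) * real (card ?Q)"
    using a a' by (intro cycle_excess_merged_products) auto
  also have "card ?K = card ?P * card ?Q"
    unfolding card_comp_transpose by (intro card_block_products[OF disj]) auto
  finally show ?thesis
    unfolding fixing_two[OF blockB a b ab] fixing_two[OF blockC a' b' ab'] by simp
qed

text \<open>
  Multiplying out the two denominators, which come from expressing \<open>harm (n + 1)\<close> and \<open>harm n\<close>
  by \<open>harm (n + 2)\<close>, leaves a polynomial with nonnegative coefficients. For \<open>n > 0\<close> the only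
  negative contributions come from the two detour classes; after multiplying out they are quartic in \<open>n\<close> with leading coefficient
  \<open>-2\<close>, against \<open>6\<close> for the factors without crossings and \<open>2\<close> for those along one edge.
\<close>

lemma cycle_excess_switched:
  "cycle_excess (B \<union> C) (harm (Suc (Suc n)) + harm (Suc (Suc n))) (cycle_factors switched) *
      ((real n + 1) * (real n + 2)) =
    (fact n)\<^sup>2 * (6 * real n ^ 4 + 8 * real n ^ 3 + 10 * real n ^ 2 + 16 * real n)"
proof -
  define H :: real where "H = harm (Suc (Suc n))"
  define x where "x = real n"
  have "x \<ge> 0" by (simp add: x_def)
  then have nz: "x + 1 \<noteq> 0" "x + 2 \<noteq> 0" by simp_all
  have h1: "harm (Suc n) = H - 1 / (x + 2)"
    by (simp add: H_def x_def harm_Suc[of "Suc n"] inverse_eq_divide add.commute)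
  have "harm (Suc n) = harm n + 1 / (x + 1)"
    by (simp add: x_def harm_Suc inverse_eq_divide add.commute)
  with h1 have h0: "harm n = H - 1 / (x + 2) - 1 / (x + 1)" by linarith
  have f1: "fact (Suc n) = (x + 1) * (fact n :: real)"
    and f2: "fact (Suc (Suc n)) = (x + 2) * (x + 1) * (fact n :: real)"
    by (simp_all add: x_def algebra_simps)
  have "cycle_excess (B \<union> C) (H + H) (cycle_factors switched) =
    (fact n)\<^sup>2 * (6 * x ^ 4 + 8 * x ^ 3 + 10 * x ^ 2 + 16 * x) / ((x + 1) * (x + 2))"
    unfolding cycle_excess_switched_eq cycle_excess_none cycle_excess_edge_a cycle_excess_edge_b
      cycle_excess_both_edges cycle_excess_detour_a cycle_excess_detour_b f2 f1
      H_def[symmetric] h1 h0 x_def[symmetric]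
    using nz by (simp add: divide_simps) algebra
  then show ?thesis
    using nz by (simp add: H_def x_def)
qed

lemma cycle_excess_switched_pos:
  assumes "n > 0"
  shows "cycle_excess (B \<union> C) (harm (Suc (Suc n)) + harm (Suc (Suc n))) (cycle_factors switched) > 0"
proof -
  have "(fact n)\<^sup>2 * (6 * real n ^ 4 + 8 * real n ^ 3 + 10 * real n ^ 2 + 16 * real n) > 0"
    using assms by (intro mult_pos_pos add_pos_pos) simp_all
  then show ?thesis
    unfolding cycle_excess_switched[symmetric] by (rule zero_less_mult_pos2) simp
qed

lemma id_mem_cycle_factors_switched: "id \<in> cycle_factors switched"
  using marked by (simp add: mem_cycle_factors_switched)

lemma pverts_switched: "pverts switched = B \<union> C"
  and parcs_switched_subset: "parcs switched \<subseteq> (B \<union> C) \<times> (B \<union> C)"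
  using marked by (auto simp: switched_def)

lemma switched_neighbours:
  assumes "v \<in> B \<union> C"
  shows "card {w. (v, w) \<in> parcs switched} = Suc (Suc n)"
proof -
  have outer: "{w. (v, w) \<in> parcs switched} = B" if "v \<in> B - {a, b}"
    using that disj marked by (auto simp: switched_def)
  have outer': "{w. (v, w) \<in> parcs switched} = C" if "v \<in> C - {a', b'}"
    using that disj marked by (auto simp: switched_def)
  have "{w. (a, w) \<in> parcs switched} = insert a' (B - {b})"
    "{w. (b, w) \<in> parcs switched} = insert b' (B - {a})"
    "{w. (a', w) \<in> parcs switched} = insert a (C - {b'})"
    "{w. (b', w) \<in> parcs switched} = insert b (C - {a'})"
    using marked by (auto simp: switched_def)
  moreover have "card (insert a' (B - {b})) = Suc (Suc n)" "card (insert b' (B - {a})) = Suc (Suc n)"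
    "card (insert a (C - {b'})) = Suc (Suc n)" "card (insert b (C - {a'})) = Suc (Suc n)"
    using marked blockB blockC by simp_all
  ultimately show ?thesis
    using assms outer outer' cardB cardC by (cases "v \<in> {a, b, a', b'}") auto
qed

lemma parcs_switched_sym: "(v, w) \<in> parcs switched \<longleftrightarrow> (w, v) \<in> parcs switched"
  by (auto simp: switched_def)

end

section \<open>Disjoint unions of digraphs\<close>

text \<open>
  Degrees as numbers of neighbours, which is how they are counted for the explicit digraphs here.
\<close>

lemma regular_digraph_iff:
  "regular_digraph d G \<longleftrightarrow> finite (pverts G) \<and> parcs G \<subseteq> pverts G \<times> pverts G \<and>
    (\<forall>v\<in>pverts G. card {u. (u, v) \<in> parcs G} = d \<and> card {w. (v, w) \<in> parcs G} = d)"
proof -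
  have "in_arcs (with_proj G) v = (\<lambda>u. (u, v)) ` {u. (u, v) \<in> parcs G}" for v
    by (auto simp: in_arcs_def)
  then have ind: "in_degree (with_proj G) v = card {u. (u, v) \<in> parcs G}" for v
    by (simp add: in_degree_def card_image inj_on_def)
  have "out_arcs (with_proj G) v = (\<lambda>w. (v, w)) ` {w. (v, w) \<in> parcs G}" for v
    by (auto simp: out_arcs_def)
  then have outd: "out_degree (with_proj G) v = card {w. (v, w) \<in> parcs G}" for v
    by (simp add: out_degree_def card_image inj_on_def)
  have "pair_fin_digraph G \<longleftrightarrow> finite (pverts G) \<and> parcs G \<subseteq> pverts G \<times> pverts G"
  proof
    assume "pair_fin_digraph G"
    then interpret pair_fin_digraph G .
    show "finite (pverts G) \<and> parcs G \<subseteq> pverts G \<times> pverts G"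
      using pair_finite_verts arc_fst_in_verts arc_snd_in_verts by (auto simp: subset_iff mem_Times_iff)
  next
    assume *: "finite (pverts G) \<and> parcs G \<subseteq> pverts G \<times> pverts G"
    then have "finite (parcs G)" by (meson finite_SigmaI finite_subset)
    with * show "pair_fin_digraph G"
      by unfold_locales (auto simp: subset_iff mem_Times_iff)
  qed
  then show ?thesis by (auto simp: regular_digraph_def ind outd)
qed

definition digraph_union :: "'a pair_pre_digraph \<Rightarrow> 'a pair_pre_digraph \<Rightarrow> 'a pair_pre_digraph" where
  "digraph_union G H = \<lparr>pverts = pverts G \<union> pverts H, parcs = parcs G \<union> parcs H\<rparr>"

lemma regular_digraph_union:
  assumes G: "regular_digraph d G" and H: "regular_digraph d H" and disj: "pverts G \<inter> pverts H = {}"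
  shows "regular_digraph d (digraph_union G H)"
proof -
  let ?U = "digraph_union G H"
  have sub: "parcs G \<subseteq> pverts G \<times> pverts G" "parcs H \<subseteq> pverts H \<times> pverts H"
    using G H by (simp_all add: regular_digraph_iff)
  have "{u. (u, v) \<in> parcs ?U} = {u. (u, v) \<in> parcs G}" "{w. (v, w) \<in> parcs ?U} = {w. (v, w) \<in> parcs G}"
    if "v \<in> pverts G" for v
    using that sub disj by (auto simp: digraph_union_def)
  moreover
  have "{u. (u, v) \<in> parcs ?U} = {u. (u, v) \<in> parcs H}" "{w. (v, w) \<in> parcs ?U} = {w. (v, w) \<in> parcs H}"
    if "v \<in> pverts H" for v
    using that sub disj by (auto simp: digraph_union_def)
  moreover have "parcs ?U \<subseteq> pverts ?U \<times> pverts ?U"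
    using sub by (auto simp: digraph_union_def)
  moreover have "pverts ?U = pverts G \<union> pverts H" by (simp add: digraph_union_def)
  ultimately show ?thesis
    using G H unfolding regular_digraph_iff by auto
qed

lemma cycle_factors_digraph_union:
  assumes "parcs G \<subseteq> pverts G \<times> pverts G" "parcs H \<subseteq> pverts H \<times> pverts H"
    and disj: "pverts G \<inter> pverts H = {}"
  shows "cycle_factors (digraph_union G H) = block_products (cycle_factors G) (cycle_factors H)"
proof (rule set_eqI)
  fix \<rho> :: "'a \<Rightarrow> 'a"
  have G: "(x, y) \<in> parcs (digraph_union G H) \<longleftrightarrow> (x, y) \<in> parcs G" if "x \<in> pverts G" for x y
    using that assms by (auto simp: digraph_union_def)
  have H: "(x, y) \<in> parcs (digraph_union G H) \<longleftrightarrow> (x, y) \<in> parcs H" if "x \<in> pverts H" for x y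
    using that assms by (auto simp: digraph_union_def)
  have V: "pverts (digraph_union G H) = pverts G \<union> pverts H"
    by (simp add: digraph_union_def)
  have in_verts: "(x, y) \<in> parcs G \<Longrightarrow> y \<in> pverts G" "(x, y) \<in> parcs H \<Longrightarrow> y \<in> pverts H" for x y
    using assms by auto
  have "\<rho> \<in> cycle_factors (digraph_union G H) \<longleftrightarrow> \<rho> permutes pverts G \<union> pverts H \<and>
      (\<forall>x\<in>pverts G. (x, \<rho> x) \<in> parcs G) \<and> (\<forall>x\<in>pverts H. (x, \<rho> x) \<in> parcs H)"
    unfolding cycle_factors_def V mem_Collect_eq ball_Un using G H by simp
  also have "\<dots> \<longleftrightarrow> \<rho> \<in> block_products (cycle_factors G) (cycle_factors H)"
    unfolding cycle_factors_def mem_block_products_iff[OF disj]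
    using in_verts by (auto simp: perm_restrict_simps)
  finally show "\<rho> \<in> cycle_factors (digraph_union G H) \<longleftrightarrow>
      \<rho> \<in> block_products (cycle_factors G) (cycle_factors H)" .
qed

lemma finite_cycle_factors: "finite (pverts G) \<Longrightarrow> finite (cycle_factors G)"
  by (rule finite_subset[OF _ finite_permutations]) (auto simp: cycle_factors_def)

lemma cycle_excess_eq_expected:
  assumes "finite (pverts G)" "cycle_factors G \<noteq> {}"
  shows "cycle_excess (pverts G) h (cycle_factors G) = card (cycle_factors G) * (expected_cycles G - h)"
  using assms finite_cycle_factors[OF assms(1)]
  by (simp add: expected_cycles_def integral_pmf_of_set cycle_excess_def sum_subtractf field_simps)

text \<open>
  Taking the two expectations as reference values makes both excesses vanish, so the excess of the
  union vanishes at their sum.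
\<close>

lemma expected_cycles_digraph_union:
  assumes "parcs G \<subseteq> pverts G \<times> pverts G" "parcs H \<subseteq> pverts H \<times> pverts H"
    and disj: "pverts G \<inter> pverts H = {}" and fin: "finite (pverts G)" "finite (pverts H)"
    and ne: "cycle_factors G \<noteq> {}" "cycle_factors H \<noteq> {}"
  shows "cycle_factors (digraph_union G H) \<noteq> {}"
    and "expected_cycles (digraph_union G H) = expected_cycles G + expected_cycles H"
proof -
  let ?U = "digraph_union G H"
  note eq = cycle_factors_digraph_union[OF assms(1-3)]
  have V: "pverts ?U = pverts G \<union> pverts H" by (simp add: digraph_union_def)
  show neU: "cycle_factors ?U \<noteq> {}"
    unfolding eq block_products_def using ne by blast
  have "cycle_excess (pverts ?U) (expected_cycles G + expected_cycles H) (cycle_factors ?U) = 0"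
    unfolding eq V using fin ne
    by (subst cycle_excess_block_products[OF disj])
      (auto simp: cycle_excess_eq_expected, auto simp: cycle_factors_def)
  moreover have "finite (pverts ?U)" using fin V by simp
  ultimately show "expected_cycles ?U = expected_cycles G + expected_cycles H"
    using neU finite_cycle_factors[of ?U] by (simp add: cycle_excess_eq_expected)
qed

lemma cycle_factors_complete_looped: "cycle_factors (complete_looped S) = {\<sigma>. \<sigma> permutes S}"
  by (auto simp: cycle_factors_def complete_looped_def permutes_in_image)

lemma cycle_factors_complete_looped_nonempty: "cycle_factors (complete_looped S) \<noteq> {}"
  unfolding cycle_factors_complete_looped using permutes_id by blast

lemma expected_cycles_complete_looped:
  assumes "finite S"
  shows "expected_cycles (complete_looped S) = harm (card S)"
proof -
  have V: "pverts (complete_looped S) = S" by (simp add: complete_looped_def)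
  have "cycle_excess S (harm (card S)) (cycle_factors (complete_looped S)) = 0"
    unfolding cycle_factors_complete_looped by (simp add: cycle_excess_permutations[OF assms])
  then show ?thesis
    using cycle_excess_eq_expected[of "complete_looped S" "harm (card S)"] assms
      cycle_factors_complete_looped_nonempty[of S] finite_cycle_factors[of "complete_looped S"]
    unfolding V by simp
qed

lemma regular_digraph_complete_looped:
  "finite S \<Longrightarrow> regular_digraph (card S) (complete_looped S)"
  by (simp add: regular_digraph_iff complete_looped_def)

lemma add_complete_block:
  fixes G :: "nat pair_pre_digraph"
  assumes G: "regular_digraph d G" "pverts G = {..<k * d}" "cycle_factors G \<noteq> {}"
  defines "G' \<equiv> digraph_union G (complete_looped {k * d..<(k + 1) * d})"
  shows "regular_digraph d G'" "pverts G' = {..<Suc k * d}" "cycle_factors G' \<noteq> {}"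
    and "expected_cycles G' = expected_cycles G + harm d"
proof -
  let ?K = "complete_looped {k * d..<(k + 1) * d}"
  have card: "card {k * d..<(k + 1) * d} = d" by simp
  have V: "pverts ?K = {k * d..<(k + 1) * d}" by (simp add: complete_looped_def)
  have K: "regular_digraph d ?K"
    using regular_digraph_complete_looped[of "{k * d..<(k + 1) * d}"] unfolding card by simp
  have disj: "pverts G \<inter> pverts ?K = {}" unfolding G(2) V by auto
  show "regular_digraph d G'"
    unfolding G'_def by (rule regular_digraph_union[OF G(1) K disj])
  show "pverts G' = {..<Suc k * d}"
    unfolding G'_def digraph_union_def using G(2) V by auto
  have *: "parcs G \<subseteq> pverts G \<times> pverts G" "parcs ?K \<subseteq> pverts ?K \<times> pverts ?K"
    "finite (pverts G)" "finite (pverts ?K)"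
    using G(1) K unfolding regular_digraph_iff by auto
  note union = expected_cycles_digraph_union[OF *(1,2) disj *(3,4) G(3)
      cycle_factors_complete_looped_nonempty]
  show "cycle_factors G' \<noteq> {}" unfolding G'_def by (rule union(1))
  show "expected_cycles G' = expected_cycles G + harm d"
    unfolding G'_def union(2) by (simp add: expected_cycles_complete_looped)
qed

lemma complete_looped_copies_Suc:
  "complete_looped_copies (Suc m) d =
    digraph_union (complete_looped_copies m d) (complete_looped {m * d..<(m + 1) * d})"
  by (simp add: complete_looped_copies_def digraph_union_def lessThan_Suc Un_commute)

lemma expected_cycles_complete_looped_copies:
  assumes "d > 0"
  shows "expected_cycles (complete_looped_copies m d) = real m * harm d"
proof -
  have "pverts (complete_looped_copies m d) = {..<m * d} \<and>
    cycle_factors (complete_looped_copies m d) \<noteq> {} \<and>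
    expected_cycles (complete_looped_copies m d) = real m * harm d"
  proof (induction m)
    case 0
    have "complete_looped_copies 0 d = complete_looped {}"
      by (simp add: complete_looped_copies_def complete_looped_def)
    then show ?case
      using expected_cycles_complete_looped[of "{} :: nat set"]
        cycle_factors_complete_looped_nonempty[of "{} :: nat set"]
      by (simp add: harm_def) (simp add: complete_looped_def)
  next
    case (Suc m)
    note block = add_complete_block[OF complete_looped_copies_regular(1)[OF assms]
        Suc.IH[THEN conjunct1] Suc.IH[THEN conjunct2, THEN conjunct1], folded complete_looped_copies_Suc]
    show ?case
    proof (intro conjI block)
      show "expected_cycles (complete_looped_copies (Suc m) d) = real (Suc m) * harm d"
        unfolding block(4) using Suc.IH by (simp add: algebra_simps)
    qed
  qed
  then show ?thesis by simp
qed

text \<open>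
  Here \<open>d \<ge> 3\<close> enters: it is the condition \<open>n > 0\<close> for the switched digraph.
\<close>

lemma exists_better_digraph_two_blocks:
  assumes "d \<ge> 3"
  obtains G :: "nat pair_pre_digraph"
  where "regular_digraph d G" "pverts G = {..<2 * d}" "cycle_factors G \<noteq> {}"
    "expected_cycles G > real 2 * harm d"
proof -
  define n where "n = d - 2"
  have d: "d = Suc (Suc n)" and n: "n > 0" using assms by (auto simp: n_def)
  interpret two_blocks "{..<d}" "{d..<2 * d}" 0 1 d "Suc d" n
    by unfold_locales (use d n in auto)
  have V: "pverts switched = {..<d} \<union> {d..<2 * d}" "{..<d} \<union> {d..<2 * d} = {..<2 * d}"
    by (rule pverts_switched) auto
  have out: "card {w. (v, w) \<in> parcs switched} = d" if "v \<in> pverts switched" for v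
    using switched_neighbours[of v] that d unfolding V(1) by simp
  then have "card {u. (u, v) \<in> parcs switched} = d" if "v \<in> pverts switched" for v
    using that parcs_switched_sym[of _ v] by simp
  moreover have "parcs switched \<subseteq> pverts switched \<times> pverts switched"
    using parcs_switched_subset unfolding pverts_switched .
  ultimately have "regular_digraph d switched"
    using out V unfolding regular_digraph_iff by simp
  moreover have ne: "cycle_factors switched \<noteq> {}"
    using id_mem_cycle_factors_switched by blast
  moreover have "expected_cycles switched > real 2 * harm d"
  proof -
    have "finite (pverts switched)" using V by simp
    then have "real (card (cycle_factors switched)) * (expected_cycles switched - (harm d + harm d)) > 0"
      using cycle_excess_switched_pos[OF n] cycle_excess_eq_expected[OF _ ne, of "harm d + harm d"]
      unfolding V(1) d[symmetric] by simp
    then show ?thesis by (simp add: zero_less_mult_iff)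
  qed
  ultimately show thesis using that V by simp
qed

lemma exists_better_digraph:
  assumes "d \<ge> 3" "k \<ge> 2"
  shows "\<exists>G :: nat pair_pre_digraph. regular_digraph d G \<and> pverts G = {..<k * d} \<and>
    cycle_factors G \<noteq> {} \<and> expected_cycles G > real k * harm d"
  using assms(2)
proof (induction k rule: nat_induct_at_least)
  case base
  show ?case using exists_better_digraph_two_blocks[OF assms(1)] by metis
next
  case (Suc k)
  then obtain G :: "nat pair_pre_digraph" where G: "regular_digraph d G" "pverts G = {..<k * d}"
    "cycle_factors G \<noteq> {}" "expected_cycles G > real k * harm d" by blast
  note G' = add_complete_block[OF G(1-3)]
  show ?case
    by (rule exI, intro conjI, rule G'(1), rule G'(2), rule G'(3))
      (use G'(4) G(4) in \<open>simp add: algebra_simps\<close>)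
qed

theorem theorem2:
  shows "(\<forall>d\<ge>3. \<forall>k\<ge>2. \<exists>G :: nat pair_pre_digraph.
            regular_digraph d G \<and> card (pverts G) = k * d \<and>
            expected_cycles G > real k * harm d) \<and>
         (\<forall>d\<ge>3. \<forall>n\<ge>2 * d. d dvd n \<longrightarrow>
            expected_cycles (complete_looped_copies (n div d) d) = real n / real d * harm d \<and>
            \<not> complete_copies_uniquely_maximise d n)"
proof (intro conjI allI impI)
  fix d k :: nat
  assume "d \<ge> 3" "k \<ge> 2"
  then show "\<exists>G :: nat pair_pre_digraph. regular_digraph d G \<and> card (pverts G) = k * d \<and>
      expected_cycles G > real k * harm d"
    using exists_better_digraph[of d k] by (metis card_lessThan)
next
  fix d n :: nat
  assume d: "d \<ge> 3" and n: "n \<ge> 2 * d" "d dvd n"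
  define k where "k = n div d"
  have nk: "n = k * d" using n(2) by (simp add: k_def)
  then have k: "k \<ge> 2" using d n(1) by simp
  have copies: "expected_cycles (complete_looped_copies (n div d) d) = real k * harm d"
    using d unfolding k_def by (intro expected_cycles_complete_looped_copies) simp
  then show "expected_cycles (complete_looped_copies (n div d) d) = real n / real d * harm d"
    using d by (simp add: nk)
  obtain G :: "nat pair_pre_digraph" where "regular_digraph d G" "pverts G = {..<k * d}"
    "expected_cycles G > real k * harm d"
    using exists_better_digraph[OF d k] by blast
  then show "\<not> complete_copies_uniquely_maximise d n"
    unfolding complete_copies_uniquely_maximise_def copies using nk by fastforce
qed

end
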